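(* Let $X \subseteq \mathbb{R}$ and $Y \subseteq \mathbb{R}$ be a pair of admissible sets and let $F : (0,\infty) \to (0,\infty)$. The following are equivalent. (1) $F \circ K$ is totally positive for every totally positive Toeplitz kernel $K$ on $X \times Y$. (2) There is a constant $c > 0$ such that $F(x) = cx$ for all $x > 0$.
   Context: A pair of subsets $X, Y \subseteq \mathbb{R}$ is admissible if, for each integer $n \geq 2$, there exist arithmetic progressions $x_1 < \cdots < x_n$ in $X$ and $y_1 < \cdots < y_n$ in $Y$ with the same increments: $x_{j+1} - x_j = y_{j+1} - y_j = x_2 - x_1$ for all $j \in \{1,\dots,n-1\}$. A kernel $K : X \times Y \to \mathbb{R}$ is Toeplitz if there is a function $f : X - Y \to \mathbb{R}$, where $X - Y = \{x-y : x \in X, y \in Y\}$, such that $K(x,y) = f(x-y)$ for all $x \in X$, $y \in Y$. $K$ is totally positive if $\det(K(x_i,y_j))_{i,j=1}^n > 0$ for all $n \in \mathbb{N}$ and all $x_1 < \cdots < x_n$ in $X$, $y_1 < \cdots < y_n$ in $Y$. *)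

theory Defs
  imports Complex_Main "Jordan_Normal_Form.Determinant"
begin

(* Kernels on X \<times> Y are total functions real \<Rightarrow> real \<Rightarrow> real of which only the values at
   points of X \<times> Y are ever inspected. Tuples x_1 < ... < x_n are indexed from 0 to n - 1,
   to agree with the indexing of matrices. *)

definition increasing_tuple :: "nat \<Rightarrow> real set \<Rightarrow> (nat \<Rightarrow> real) \<Rightarrow> bool" where
  "increasing_tuple n X x \<longleftrightarrow> strict_mono_on {..<n} x \<and> x ` {..<n} \<subseteq> X"

definition admissible :: "real set \<Rightarrow> real set \<Rightarrow> bool" where
  "admissible X Y \<longleftrightarrow>
    (\<forall>n\<ge>2. \<exists>x y. increasing_tuple n X x \<and> increasing_tuple n Y y \<and>
       (\<forall>j. Suc j < n \<longrightarrow>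
          x (Suc j) - x j = x 1 - x 0 \<and> y (Suc j) - y j = x 1 - x 0))"

(* f is total here; only its values on X - Y matter. *)
definition toeplitz_kernel :: "real set \<Rightarrow> real set \<Rightarrow> (real \<Rightarrow> real \<Rightarrow> real) \<Rightarrow> bool" where
  "toeplitz_kernel X Y K \<longleftrightarrow>
    (\<exists>f :: real \<Rightarrow> real. \<forall>x\<in>X. \<forall>y\<in>Y. K x y = f (x - y))"

definition totally_positive :: "real set \<Rightarrow> real set \<Rightarrow> (real \<Rightarrow> real \<Rightarrow> real) \<Rightarrow> bool" where
  "totally_positive X Y K \<longleftrightarrow>
    (\<forall>n\<ge>1. \<forall>x y. increasing_tuple n X x \<longrightarrow> increasing_tuple n Y y \<longrightarrow>
       det (mat n n (\<lambda>(i, j). K (x i) (y j))) > 0)"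

end

theory Submission
  imports "HOL-Analysis.Interval_Integral" Defs
begin

text \<open>Rescaling a totally positive function \<open>f\<close> on the real line to a common progression of \<open>X\<close> and
  \<open>Y\<close> shows that a preserver \<open>F\<close> keeps all minors of \<open>f (x - y)\<close> on equally spaced grids positive.
  Gaussians and \<open>2 \<times> 2\<close> minors make \<open>F\<close> increasing, continuous and multiplicatively midpoint concave.
  Further totally positive functions arise from \<open>exp (- exp (- L x))\<close> by convolution with one-sided
  exponentials; as \<open>L\<close> grows they converge for \<open>x > 0\<close> to multiples of \<open>1 - exp (- 2 x)\<close> and
  \<open>1 - 3 exp (- 2 x) + 2 exp (- 3 x)\<close>. In a minor of \<open>F \<circ> f\<close>, sending the last point of \<open>x\<close> to \<open>\<infinity>\<close> and the
  first point of \<open>y\<close> to \<open>-\<infinity>\<close> subtracts the limit at \<open>\<infinity>\<close>. Thus the \<open>3 \<times> 3\<close> minors for the first function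
  say that \<open>F A - F (A - exp (- 2 x))\<close> is log-concave in \<open>x\<close>, so \<open>F\<close> is convex. For the second function,
  subtracting also the tangent term in the \<open>4 \<times> 4\<close> minors leaves a log-concave function in which a
  quadratic remainder of \<open>F\<close> at \<open>A\<close>, of order \<open>exp (- 4 x)\<close>, would follow the term of order
  \<open>exp (- 3 x)\<close> with the wrong sign. So \<open>F\<close> is affine below every \<open>A\<close> where a parabola touches
  its graph from above, and midpoint concavity together with positivity removes the constant term.\<close>

section \<open>Determinants with varying rows\<close>

text \<open>The cofactors along row \<open>m\<close> ignore that row, so the determinant is linear
  in it with fixed coefficients. This turns a determinant into a scalar function of the parameter of
  one row.\<close>

lemma det_replace_row:
  fixes B :: "nat \<Rightarrow> nat \<Rightarrow> 'a :: comm_ring_1"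
  assumes "m < n"
  shows "det (mat n n (\<lambda>(i, j). if i = m then v j else B i j)) =
    (\<Sum>j<n. v j * cofactor (mat n n (\<lambda>(i, j). B i j)) m j)"
proof -
  let ?A = "mat n n (\<lambda>(i, j). if i = m then v j else B i j)"
  have "det ?A = (\<Sum>j<n. ?A $$ (m, j) * cofactor ?A m j)"
    by (rule laplace_expansion_row) (use assms in auto)
  also have "\<dots> = (\<Sum>j<n. v j * cofactor (mat n n (\<lambda>(i, j). B i j)) m j)"
  proof (rule sum.cong)
    fix j assume "j \<in> {..<n}"
    have "mat_delete ?A m j = mat_delete (mat n n (\<lambda>(i, j). B i j)) m j"
      unfolding mat_delete_def by (rule eq_matI) auto
    then show "?A $$ (m, j) * cofactor ?A m j = v j * cofactor (mat n n (\<lambda>(i, j). B i j)) m j"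
      using \<open>j \<in> {..<n}\<close> assms by (simp add: cofactor_def)
  qed simp
  finally show ?thesis .
qed

lemma det_mat_cong:
  assumes "\<And>i j. i < n \<Longrightarrow> j < n \<Longrightarrow> A i j = B i j"
  shows "det (mat n n (\<lambda>(i, j). A i j)) = det (mat n n (\<lambda>(i, j). B i j))"
  by (rule arg_cong[where f = det]) (auto intro!: eq_matI simp: assms)

text \<open>Each permutation meets every row and every column once. Exponentials of
  \<open>x i - y j\<close> split into positive row and column factors, so they do not affect the
  sign of a minor.\<close>

lemma det_scale:
  fixes A :: "nat \<Rightarrow> nat \<Rightarrow> 'a :: comm_ring_1"
  shows "det (mat n n (\<lambda>(i, j). r i * c j * A i j)) =
    (\<Prod>i<n. r i) * (\<Prod>j<n. c j) * det (mat n n (\<lambda>(i, j). A i j))"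
proof -
  have *: "(\<Prod>i = 0..<n. r i * c (p i) * A i (p i)) =
      (\<Prod>i<n. r i) * (\<Prod>j<n. c j) * (\<Prod>i = 0..<n. A i (p i))"
    if "p permutes {0..<n}" for p
    using prod.permute[OF that, of c] by (simp add: prod.distrib o_def atLeast0LessThan)
  have in_range: "i < n \<Longrightarrow> p permutes {0..<n} \<Longrightarrow> p i < n" for p and i :: nat
    using permutes_in_image[of p "{0..<n}" i] by auto
  have "det (mat n n (\<lambda>(i, j). r i * c j * A i j)) =
      (\<Sum>p | p permutes {0..<n}. signof p * (\<Prod>i = 0..<n. r i * c (p i) * A i (p i)))"
    by (subst det_def'[where n = n]) (auto simp: in_range intro!: sum.cong prod.cong)
  also have "\<dots> = (\<Prod>i<n. r i) * (\<Prod>j<n. c j) *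
      (\<Sum>p | p permutes {0..<n}. signof p * (\<Prod>i = 0..<n. A i (p i)))"
    unfolding sum_distrib_left
  proof (rule sum.cong)
    fix p assume "p \<in> {p. p permutes {0..<n}}"
    then have "(\<Prod>i = 0..<n. r i * c (p i) * A i (p i)) =
        (\<Prod>i<n. r i) * (\<Prod>j<n. c j) * (\<Prod>i = 0..<n. A i (p i))"
      by (simp only: mem_Collect_eq *)
    then show "signof p * (\<Prod>i = 0..<n. r i * c (p i) * A i (p i)) =
        (\<Prod>i<n. r i) * (\<Prod>j<n. c j) * (signof p * (\<Prod>i = 0..<n. A i (p i)))"
      by (simp only: mult_ac)
  qed simp
  also have "(\<Sum>p | p permutes {0..<n}. signof p * (\<Prod>i = 0..<n. A i (p i))) =
      det (mat n n (\<lambda>(i, j). A i j))"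
    by (subst det_def'[where n = n]) (auto simp: in_range intro!: sum.cong prod.cong)
  finally show ?thesis .
qed

text \<open>Differencing is left multiplication by a lower bidiagonal matrix with unit
  diagonal.\<close>

lemma det_difference_rows:
  fixes B :: "nat \<Rightarrow> nat \<Rightarrow> real"
  shows "det (mat n n (\<lambda>(i, j). if i = 0 then B 0 j else B i j - B (i - 1) j)) =
    det (mat n n (\<lambda>(i, j). B i j))"
proof -
  define L :: "real mat" where
    "L = mat n n (\<lambda>(i, k). if k = i then 1 else if Suc k = i then -1 else 0)"
  have L: "L \<in> carrier_mat n n" by (simp add: L_def)
  have "det L = prod_list (diag_mat L)"
    by (rule det_lower_triangular[OF _ L]) (auto simp: L_def)
  also have "diag_mat L = map (\<lambda>i. 1) [0..<n]"
    by (auto simp: diag_mat_def L_def intro!: map_cong)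
  finally have det_L: "det L = 1"
    by (simp add: map_replicate_const)
  have "mat n n (\<lambda>(i, j). if i = 0 then B 0 j else B i j - B (i - 1) j) =
      L * mat n n (\<lambda>(i, j). B i j)"
  proof (rule eq_matI)
    fix i j assume "i < dim_row (L * mat n n (\<lambda>(i, j). B i j))"
      and "j < dim_col (L * mat n n (\<lambda>(i, j). B i j))"
    then have ij: "i < n" "j < n" by (simp_all add: L_def)
    then have "(L * mat n n (\<lambda>(i, j). B i j)) $$ (i, j) =
        (\<Sum>k<n. (if k = i then 1 else if Suc k = i then -1 else 0) * B k j)"
      by (simp add: L_def scalar_prod_def atLeast0LessThan)
    also have "\<dots> = (\<Sum>k<n. if k = i then B k j else 0) - (\<Sum>k<n. if Suc k = i then B k j else 0)"
      by (subst sum_subtractf[symmetric]) (intro sum.cong, auto)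
    also have "\<dots> = (if i = 0 then B 0 j else B i j - B (i - 1) j)"
      using ij by (cases i) auto
    finally show "mat n n (\<lambda>(i, j). if i = 0 then B 0 j else B i j - B (i - 1) j) $$ (i, j) =
        (L * mat n n (\<lambda>(i, j). B i j)) $$ (i, j)"
      using ij by simp
  qed (auto simp: L_def)
  then show ?thesis
    using det_mult[OF L, of "mat n n (\<lambda>(i, j). B i j)"] det_L by simp
qed

text \<open>Differencing the rows turns the first column into a unit vector, so a single cofactor
  survives.\<close>

lemma det_first_column_ones:
  fixes B :: "nat \<Rightarrow> nat \<Rightarrow> real"
  assumes "\<And>i. i \<le> n \<Longrightarrow> B i 0 = 1"
  shows "det (mat (Suc n) (Suc n) (\<lambda>(i, j). B i j)) =
    det (mat n n (\<lambda>(i, j). B (Suc i) (Suc j) - B i (Suc j)))"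
proof -
  define A where "A = mat (Suc n) (Suc n) (\<lambda>(i, j). if i = 0 then B 0 j else B i j - B (i - 1) j)"
  have "det A = (\<Sum>i<Suc n. A $$ (i, 0) * cofactor A i 0)"
    by (rule laplace_expansion_column) (auto simp: A_def)
  also have "\<dots> = A $$ (0, 0) * cofactor A 0 0"
    by (subst sum.remove[of _ 0]) (auto intro!: sum.neutral simp: A_def assms)
  also have "\<dots> = det (mat_delete A 0 0)"
    by (simp add: A_def assms cofactor_def)
  also have "mat_delete A 0 0 = mat n n (\<lambda>(i, j). B (Suc i) (Suc j) - B i (Suc j))"
    unfolding mat_delete_def A_def by (rule eq_matI) auto
  finally show ?thesis
    using det_difference_rows[of "Suc n" B] by (simp add: A_def)
qed

text \<open>Mean value theorem, one row at a time.\<close>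

lemma det_increments_pos:
  fixes R R' :: "real \<Rightarrow> nat \<Rightarrow> real"
  assumes deriv: "\<And>s j. j < n \<Longrightarrow> ((\<lambda>s. R s j) has_real_derivative R' s j) (at s)"
    and pos: "\<And>t. strict_mono_on {..<n} t \<Longrightarrow> 0 < det (mat n n (\<lambda>(i, j). R' (t i) j))"
    and ab: "\<And>i. i < n \<Longrightarrow> a i < b i" "\<And>i. Suc i < n \<Longrightarrow> b i \<le> a (Suc i)"
  shows "0 < det (mat n n (\<lambda>(i, j). R (b i) j - R (a i) j))"
proof -
  \<comment> \<open>Rows with index less than \<open>m\<close> are already increments; the others
    are derivatives at arbitrary points of their intervals. Keeping \<open>t\<close> general leaves
    the mean value theorem free to choose the next point.\<close>
  have "0 < det (mat n n (\<lambda>(i, j). if i < m then R (b i) j - R (a i) j else R' (t i) j))"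
    if "m \<le> n" "\<And>i. i < n \<Longrightarrow> a i < t i \<and> t i < b i" for m t
    using that
  proof (induction m arbitrary: t)
    case 0
    have "t i < t j" if "i < j" "j < n" for i j
      using that
    proof (induction j)
      case (Suc j)
      have "t j < t (Suc j)"
        using 0(2)[of j] 0(2)[of "Suc j"] ab(2)[of j] Suc.prems by auto
      then show ?case using Suc by (cases "i = j") auto
    qed simp
    then have "strict_mono_on {..<n} t" by (auto simp: strict_mono_on_def)
    then show ?case using pos by simp
  next
    case (Suc m)
    then have m: "m < n" by simp
    define B where "B = (\<lambda>i j. if i < m then R (b i) j - R (a i) j else R' (t i) j)"
    define w where "w = cofactor (mat n n (\<lambda>(i, j). B i j)) m"
    have det: "det (mat n n (\<lambda>(i, j). if i = m then v j else B i j)) = (\<Sum>j<n. v j * w j)" for v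
      unfolding w_def by (rule det_replace_row[OF m])
    define \<psi> where "\<psi> s = (\<Sum>j<n. R s j * w j)" for s
    have \<psi>': "(\<psi> has_real_derivative (\<Sum>j<n. R' s j * w j)) (at s)" for s
      unfolding \<psi>_def by (intro derivative_intros) (auto intro!: derivative_eq_intros deriv)
    obtain s where s: "a m < s" "s < b m"
      and eq: "\<psi> (b m) - \<psi> (a m) = (b m - a m) * (\<Sum>j<n. R' s j * w j)"
      using MVT2[OF ab(1)[OF m], of \<psi> "\<lambda>s. \<Sum>j<n. R' s j * w j"] \<psi>' by blast
    have "0 < det (mat n n (\<lambda>(i, j). if i < m then R (b i) j - R (a i) j else R' ((t(m := s)) i) j))"
      using Suc.IH[of "t(m := s)"] Suc.prems s by auto
    also have "\<dots> = det (mat n n (\<lambda>(i, j). if i = m then R' s j else B i j))"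
      by (rule det_mat_cong) (auto simp: B_def)
    finally have "0 < \<psi> (b m) - \<psi> (a m)"
      using eq ab(1)[OF m] by (simp add: det)
    also have "\<dots> = det (mat n n (\<lambda>(i, j). if i = m then R (b m) j - R (a m) j else B i j))"
      by (simp add: det \<psi>_def sum_subtractf left_diff_distrib)
    also have "\<dots> = det (mat n n (\<lambda>(i, j). if i < Suc m then R (b i) j - R (a i) j else R' (t i) j))"
      by (rule det_mat_cong) (auto simp: B_def)
    finally show ?case .
  qed
  \<comment> \<open>At \<open>m = n\<close> no \<open>t i\<close> occurs in the matrix any more; the
    midpoints are mere placeholders inside the intervals.\<close>
  from this[of n "\<lambda>i. (a i + b i) / 2"] ab(1)
  have "0 < det (mat n n (\<lambda>(i, j). if i < n then R (b i) j - R (a i) j else R' ((a i + b i) / 2) j))"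
    by (simp add: field_simps)
  also have "\<dots> = det (mat n n (\<lambda>(i, j). R (b i) j - R (a i) j))"
    by (rule det_mat_cong) auto
  finally show ?thesis .
qed

section \<open>Totally positive functions on the line\<close>

text \<open>Total positivity of the Toeplitz kernel \<open>f (x - y)\<close> on the whole line.
  Integrability, as for Polya frequency functions, is not demanded.\<close>

definition tp_function :: "(real \<Rightarrow> real) \<Rightarrow> bool" where
  "tp_function f \<longleftrightarrow>
    (\<forall>n x y. strict_mono_on {..<n} x \<longrightarrow> strict_mono_on {..<n} y \<longrightarrow>
       0 < det (mat n n (\<lambda>(i, j). f (x i - y j))))"

lemma tp_functionD:
  "tp_function f \<Longrightarrow> strict_mono_on {..<n} x \<Longrightarrow> strict_mono_on {..<n} y \<Longrightarrow>
    0 < det (mat n n (\<lambda>(i, j). f (x i - y j)))"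
  by (simp add: tp_function_def)

text \<open>Dividing row \<open>i\<close> by \<open>exp (x i * y 0)\<close> makes the first column
  constant, and row differences lower the size by one. By the mean value theorem it is enough to
  treat the derivatives, which form a smaller exponential kernel with positive column
  factors.\<close>

lemma det_exp_kernel_pos:
  assumes "strict_mono_on {..<n} x" "strict_mono_on {..<n} y"
  shows "0 < det (mat n n (\<lambda>(i, j). exp (x i * y j :: real)))"
  using assms
proof (induction n arbitrary: x y)
  case (Suc n)
  define B where "B i j = exp (x i * (y j - y 0))" for i j
  define c where "c j = y (Suc j) - y 0" for j
  have c: "strict_mono_on {..<n} c"
    using Suc.prems(2) by (auto simp: strict_mono_on_def c_def)
  have c_pos: "0 < c j" if "j < n" for j
    using Suc.prems(2) that by (auto simp: strict_mono_on_def c_def)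
  have "0 < det (mat n n (\<lambda>(i, j). exp (x (Suc i) * c j) - exp (x i * c j)))"
  proof (rule det_increments_pos[where R = "\<lambda>s j. exp (s * c j)" and R' = "\<lambda>s j. c j * exp (s * c j)"])
    fix t :: "nat \<Rightarrow> real" assume "strict_mono_on {..<n} t"
    then have "0 < det (mat n n (\<lambda>(i, j). exp (t i * c j)))"
      by (rule Suc.IH) (rule c)
    moreover have "0 < (\<Prod>j<n. c j)"
      using c_pos by (auto intro: prod_pos)
    ultimately show "0 < det (mat n n (\<lambda>(i, j). c j * exp (t i * c j)))"
      using det_scale[of n "\<lambda>_. 1" c "\<lambda>i j. exp (t i * c j)"] by simp
  qed (use Suc.prems(1) in \<open>auto intro!: derivative_eq_intros simp: strict_mono_on_def\<close>)
  also have "\<dots> = det (mat (Suc n) (Suc n) (\<lambda>(i, j). B i j))"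
    by (subst det_first_column_ones) (auto simp: B_def c_def)
  finally have "0 < (\<Prod>i<Suc n. exp (x i * y 0)) * (\<Prod>j<Suc n. 1) *
      det (mat (Suc n) (Suc n) (\<lambda>(i, j). B i j))"
    by (simp add: prod_pos)
  also have "\<dots> = det (mat (Suc n) (Suc n) (\<lambda>(i, j). exp (x i * y j)))"
    unfolding det_scale[symmetric]
    by (rule det_mat_cong) (simp add: B_def exp_add[symmetric] algebra_simps)
  finally show ?case .
qed simp

lemma tp_function_scale:
  assumes "tp_function f" "0 < c"
  shows "tp_function (\<lambda>x. c * f x)"
  unfolding tp_function_def
proof (intro allI impI)
  fix n and x y :: "nat \<Rightarrow> real"
  assume "strict_mono_on {..<n} x" "strict_mono_on {..<n} y"
  then have "0 < det (mat n n (\<lambda>(i, j). f (x i - y j)))"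
    by (rule tp_functionD[OF assms(1)])
  with \<open>0 < c\<close> show "0 < det (mat n n (\<lambda>(i, j). c * f (x i - y j)))"
    using det_scale[of n "\<lambda>_. c" "\<lambda>_. 1" "\<lambda>i j. f (x i - y j)"] by simp
qed

text \<open>Expanding the square leaves the kernel \<open>exp (2 * \<beta> * x * y)\<close> up to
  row and column factors.\<close>

lemma tp_function_gaussian:
  assumes "0 < \<beta>"
  shows "tp_function (\<lambda>x. exp (\<gamma> * x - \<beta> * x\<^sup>2))"
  unfolding tp_function_def
proof (intro allI impI)
  fix n and x y :: "nat \<Rightarrow> real"
  assume "strict_mono_on {..<n} x" "strict_mono_on {..<n} y"
  with \<open>0 < \<beta>\<close> have "0 < det (mat n n (\<lambda>(i, j). exp (x i * (2 * \<beta> * y j))))"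
    by (intro det_exp_kernel_pos) (auto simp: strict_mono_on_def)
  then have "0 < (\<Prod>i<n. exp (\<gamma> * x i - \<beta> * (x i)\<^sup>2)) * (\<Prod>j<n. exp (- \<gamma> * y j - \<beta> * (y j)\<^sup>2)) *
      det (mat n n (\<lambda>(i, j). exp (x i * (2 * \<beta> * y j))))"
    by (simp add: prod_pos)
  also have "\<dots> = det (mat n n (\<lambda>(i, j). exp (\<gamma> * (x i - y j) - \<beta> * (x i - y j)\<^sup>2)))"
    unfolding det_scale[symmetric]
    by (rule det_mat_cong) (simp add: exp_add[symmetric] power2_eq_square algebra_simps)
  finally show "0 < det (mat n n (\<lambda>(i, j). exp (\<gamma> * (x i - y j) - \<beta> * (x i - y j)\<^sup>2)))" .
qed

text \<open>This is the exponential kernel in the increasing variables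
  \<open>- exp (- L * x)\<close> and \<open>exp (L * y)\<close>.\<close>

lemma tp_function_gumbel:
  assumes "0 < L"
  shows "tp_function (\<lambda>x. exp (- exp (- L * x)))"
  unfolding tp_function_def
proof (intro allI impI)
  fix n and x y :: "nat \<Rightarrow> real"
  assume "strict_mono_on {..<n} x" "strict_mono_on {..<n} y"
  with \<open>0 < L\<close> have "0 < det (mat n n (\<lambda>(i, j). exp ((- exp (- L * x i)) * exp (L * y j))))"
    by (intro det_exp_kernel_pos) (auto simp: strict_mono_on_def)
  also have "\<dots> = det (mat n n (\<lambda>(i, j). exp (- exp (- L * (x i - y j)))))"
    by (rule det_mat_cong) (simp add: exp_add[symmetric] algebra_simps)
  finally show "0 < det (mat n n (\<lambda>(i, j). exp (- exp (- L * (x i - y j)))))" .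
qed

text \<open>The hypotheses say that \<open>g\<close> is the convolution of \<open>f\<close> with the one-sided exponential
  \<open>exp (- a x)\<close>, \<open>x > 0\<close>.\<close>

lemma tp_function_convolution:
  assumes tp: "tp_function f"
    and deriv: "\<And>x. (g has_real_derivative f x - a * g x) (at x)"
    and lim: "((\<lambda>x. exp (a * x) * g x) \<longlongrightarrow> 0) at_bot"
  shows "tp_function g"
  unfolding tp_function_def
proof (intro allI impI)
  fix n and x y :: "nat \<Rightarrow> real"
  assume x: "strict_mono_on {..<n} x" and y: "strict_mono_on {..<n} y"
  \<comment> \<open>The integrating factor cancels the term \<open>- a * g x\<close>, so the
    derivative of \<open>R\<close> involves \<open>f\<close> alone.\<close>
  define R where "R s j = exp (a * (s - y j)) * g (s - y j)" for s j
  define R' where "R' s j = exp (a * (s - y j)) * f (s - y j)" for s j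
  have R': "((\<lambda>s. R s j) has_real_derivative R' s j) (at s)" for s j
    unfolding R_def R'_def
    by (auto intro!: derivative_eq_intros DERIV_chain2[OF deriv] simp: algebra_simps)
  have R'_pos: "0 < det (mat n n (\<lambda>(i, j). R' (t i) j))" if "strict_mono_on {..<n} t" for t
  proof -
    have "0 < (\<Prod>i<n. exp (a * t i)) * (\<Prod>j<n. exp (- a * y j)) *
        det (mat n n (\<lambda>(i, j). f (t i - y j)))"
      using tp_functionD[OF tp that y] by (simp add: prod_pos)
    then show ?thesis
      unfolding det_scale[symmetric] R'_def by (simp add: exp_add[symmetric] algebra_simps)
  qed
  have "0 < det (mat n n (\<lambda>(i, j). R (x i) j))"
  proof (cases "n = 0")
    case False
    \<comment> \<open>Row 0, where \<open>i - 1\<close> truncates to 0, is always replaced by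
      another row.\<close>
    define B where "B i j = R (x i) j - R (x (i - 1)) j" for i j
    define w where "w = cofactor (mat n n (\<lambda>(i, j). B i j)) 0"
    define \<psi> where "\<psi> s = (\<Sum>j<n. R s j * w j)" for s
    have det: "det (mat n n (\<lambda>(i, j). if i = 0 then v j else B i j)) = (\<Sum>j<n. v j * w j)" for v
      unfolding w_def by (rule det_replace_row) (use False in simp)
    have \<psi>_less: "\<psi> s < \<psi> s'" if "s < s'" "s' \<le> x 0" for s s'
    proof -
      have "0 < det (mat n n (\<lambda>(i, j). R (if i = 0 then s' else x i) j - R (if i = 0 then s else x (i - 1)) j))"
        by (rule det_increments_pos[where R = R and R' = R'])
          (use that x R'_pos R' in \<open>auto simp: strict_mono_on_def\<close>)
      also have "\<dots> = det (mat n n (\<lambda>(i, j). if i = 0 then R s' j - R s j else B i j))"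
        by (rule det_mat_cong) (simp add: B_def)
      also have "\<dots> = \<psi> s' - \<psi> s"
        by (simp add: det \<psi>_def sum_subtractf left_diff_distrib)
      finally show ?thesis by simp
    qed
    have "((\<lambda>s. R s j) \<longlongrightarrow> 0) at_bot" for j
      unfolding R_def
      by (rule filterlim_compose[OF lim]) (simp add: filterlim_at_bot_mirror, real_asymp)
    then have "(\<psi> \<longlongrightarrow> (\<Sum>j<n. 0 * w j)) at_bot"
      unfolding \<psi>_def by (intro tendsto_intros)
    then have "(\<psi> \<longlongrightarrow> 0) at_bot" by simp
    \<comment> \<open>Since \<open>\<psi>\<close> increases from its limit 0, it is nonnegative at
      \<open>x 0 - 1\<close>; the remaining unit step makes the inequality at \<open>x 0\<close>
      strict.\<close>
    moreover have "eventually (\<lambda>s. \<psi> s \<le> \<psi> (x 0 - 1)) at_bot"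
      using eventually_gt_at_bot[of "x 0 - 1"]
      by eventually_elim (use \<psi>_less in \<open>force intro: less_imp_le\<close>)
    ultimately have "0 \<le> \<psi> (x 0 - 1)"
      by (rule tendsto_upperbound) simp
    also have "\<dots> < \<psi> (x 0)" by (rule \<psi>_less) auto
    also have "\<psi> (x 0) = det (mat n n (\<lambda>(i, j). if i = 0 then R (x 0) j else R (x i) j - R (x (i - 1)) j))"
      unfolding \<psi>_def det[symmetric] by (rule det_mat_cong) (simp add: B_def)
    also have "\<dots> = det (mat n n (\<lambda>(i, j). R (x i) j))"
      by (rule det_difference_rows[of n "\<lambda>i. R (x i)"])
    finally show ?thesis .
  qed simp
  then have "0 < (\<Prod>i<n. exp (- a * x i)) * (\<Prod>j<n. exp (a * y j)) *
      det (mat n n (\<lambda>(i, j). R (x i) j))"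
    by (simp add: prod_pos)
  also have "\<dots> = det (mat n n (\<lambda>(i, j). g (x i - y j)))"
    unfolding det_scale[symmetric]
    by (rule det_mat_cong) (simp add: R_def right_diff_distrib exp_diff exp_minus)
  finally show "0 < det (mat n n (\<lambda>(i, j). g (x i - y j)))" .
qed

section \<open>Convolution with one-sided exponentials\<close>

text \<open>No improper integral is formed: an antiderivative \<open>H\<close> of
  \<open>exp (a * x) * f x\<close> is increasing and, by the exponential bound on \<open>f\<close>,
  bounded below. Its infimum \<open>C\<close> serves as its value at minus infinity.\<close>

lemma convolution_exists:
  fixes f :: "real \<Rightarrow> real"
  assumes cont: "\<And>x. isCont f x"
    and bounds: "\<And>x. 0 \<le> f x" "\<And>x. f x \<le> B * exp (L * x)"
    and "0 < L + a"
  obtains g where "\<And>x. (g has_real_derivative f x - a * g x) (at x)"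
    and "\<And>x. 0 \<le> g x" "\<And>x. g x \<le> B / (L + a) * exp (L * x)"
proof -
  have "isCont (\<lambda>x. exp (a * x) * f x) x" for x
    using cont by (intro continuous_intros) auto
  then obtain H where H: "(H has_real_derivative exp (a * x) * f x) (at x)" for x
    using einterval_antiderivative[of "-\<infinity>" "\<infinity>" "\<lambda>x. exp (a * x) * f x"]
    by (auto simp: has_real_derivative_iff_has_vector_derivative)
  define W where "W x = B / (L + a) * exp ((L + a) * x)" for x
  have W: "(W has_real_derivative B * exp ((L + a) * x)) (at x)" for x
    unfolding W_def using \<open>0 < L + a\<close> by (auto intro!: derivative_eq_intros)
  have "0 \<le> B" using bounds[of 0] by simp
  have H_mono: "H s \<le> H x" if "s \<le> x" for s x
    by (rule DERIV_nonneg_imp_nondecreasing[OF that]) (use H bounds in \<open>metis exp_ge_zero mult_nonneg_nonneg\<close>)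
  have WH: "W s - H s \<le> W x - H x" if "s \<le> x" for s x
  proof (rule DERIV_nonneg_imp_nondecreasing[OF that])
    fix t
    have "exp (a * t) * f t \<le> exp (a * t) * (B * exp (L * t))"
      using bounds by (intro mult_left_mono) auto
    also have "\<dots> = B * exp ((L + a) * t)"
      by (simp add: exp_add[symmetric] algebra_simps)
    finally show "\<exists>y. ((\<lambda>t. W t - H t) has_real_derivative y) (at t) \<and> 0 \<le> y"
      by (intro exI[of _ "B * exp ((L + a) * t) - exp (a * t) * f t"] conjI DERIV_diff W H) simp
  qed
  have W_nonneg: "0 \<le> W s" for s
    using \<open>0 \<le> B\<close> \<open>0 < L + a\<close> by (simp add: W_def)
  have lower: "H x - W x \<le> H s" for s x
    using H_mono[of x s] WH[of s x] W_nonneg[of s] W_nonneg[of x] by (cases "s \<le> x") auto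
  define C where "C = (INF s. H s)"
  have C: "H x - W x \<le> C" "C \<le> H x" for x
    using lower unfolding C_def by (auto intro!: cINF_greatest cINF_lower bdd_belowI2)
  show thesis
  proof
    let ?g = "\<lambda>x. exp (- a * x) * (H x - C)"
    fix x
    show "(?g has_real_derivative f x - a * ?g x) (at x)"
      by (auto intro!: derivative_eq_intros H simp: exp_minus field_simps)
    show "0 \<le> ?g x" using C by simp
    have "?g x \<le> exp (- a * x) * W x"
      using C(1)[of x] by (intro mult_left_mono) auto
    also have "\<dots> = B / (L + a) * exp (L * x)"
      by (simp add: W_def exp_add[symmetric] algebra_simps)
    finally show "?g x \<le> B / (L + a) * exp (L * x)" .
  qed
qed

text \<open>The bound on \<open>g\<close> has the shape of the bound on \<open>f\<close> with the
  same \<open>L\<close>, so the construction can be iterated.\<close>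

lemma tp_convolution_exists:
  fixes f :: "real \<Rightarrow> real"
  assumes "tp_function f" "\<And>x. isCont f x" "\<And>x. 0 \<le> f x" "\<And>x. f x \<le> B * exp (L * x)" "0 < L + a"
  obtains g where "tp_function g" "\<And>x. (g has_real_derivative f x - a * g x) (at x)"
    and "\<And>x. 0 \<le> g x" "\<And>x. g x \<le> B / (L + a) * exp (L * x)"
proof -
  obtain g where g: "\<And>x. (g has_real_derivative f x - a * g x) (at x)"
    "\<And>x. 0 \<le> g x" "\<And>x. g x \<le> B / (L + a) * exp (L * x)"
    using convolution_exists[OF assms(2-5)] by blast
  have "((\<lambda>x. exp (a * x) * g x) \<longlongrightarrow> 0) at_bot"
  proof (rule tendsto_sandwich[OF _ _ tendsto_const])
    show "\<forall>\<^sub>F x in at_bot. 0 \<le> exp (a * x) * g x"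
      using g(2) by simp
    have "exp (a * x) * g x \<le> B / (L + a) * exp ((L + a) * x)" for x
    proof -
      have "exp (a * x) * g x \<le> exp (a * x) * (B / (L + a) * exp (L * x))"
        using g(3) by (intro mult_left_mono) auto
      then show ?thesis by (simp add: exp_add algebra_simps)
    qed
    then show "\<forall>\<^sub>F x in at_bot. exp (a * x) * g x \<le> B / (L + a) * exp ((L + a) * x)"
      by simp
    show "((\<lambda>x. B / (L + a) * exp ((L + a) * x)) \<longlongrightarrow> 0) at_bot"
      using \<open>0 < L + a\<close> by real_asymp
  qed
  from tp_function_convolution[OF assms(1) g(1) this] show thesis
    using g that by blast
qed

text \<open>Both functions solve the same linear equation, so their weighted difference
  \<open>P\<close> is driven by \<open>f x - \<phi> x\<close> only. The error term
  \<open>exp (- L * x)\<close> allows for a layer near 0, which contributes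
  \<open>1 / (L - a)\<close>.\<close>

lemma convolution_approximation:
  fixes f g \<phi> \<gamma> :: "real \<Rightarrow> real"
  assumes g: "\<And>x. (g has_real_derivative f x - a * g x) (at x)"
    and \<gamma>: "\<And>x. (\<gamma> has_real_derivative \<phi> x - a * \<gamma> x) (at x)" "\<gamma> 0 = 0"
    and approx: "\<And>x. 0 \<le> x \<Longrightarrow> \<bar>f x - \<phi> x\<bar> \<le> \<epsilon> + exp (- L * x)"
    and "0 < a" "a < L" "0 \<le> \<epsilon>" "0 \<le> g 0" "0 \<le> x"
  shows "\<bar>g x - \<gamma> x\<bar> \<le> g 0 + \<epsilon> / a + 1 / (L - a)"
proof -
  define P where "P x = exp (a * x) * (g x - \<gamma> x)" for x
  \<comment> \<open>An antiderivative of \<open>exp (a * x) * (\<epsilon> + exp (- L * x))\<close>,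
    with the constant chosen so that \<open>Q 0\<close> is at least
    \<open>\<bar>P 0\<bar>\<close>.\<close>
  define Q where "Q x = g 0 + \<epsilon> / a * exp (a * x) + 1 / (L - a) - 1 / (L - a) * exp ((a - L) * x)" for x
  have P': "(P has_real_derivative exp (a * x) * (f x - \<phi> x)) (at x)" for x
    unfolding P_def by (auto intro!: derivative_eq_intros g \<gamma> simp: algebra_simps)
  have Q': "(Q has_real_derivative exp (a * x) * (\<epsilon> + exp (- L * x))) (at x)" for x
  proof -
    have "1 / k * (- k * E) = - E" if "k \<noteq> 0" for k E :: real
      using that by simp
    from this[of "L - a" "exp ((a - L) * x)"]
    have "1 / (L - a) * ((a - L) * exp ((a - L) * x)) = - (exp (a * x) * exp (- L * x))"
      using \<open>a < L\<close> by (simp add: exp_add[symmetric] algebra_simps)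
    moreover have "(Q has_real_derivative
        \<epsilon> / a * (a * exp (a * x)) - 1 / (L - a) * ((a - L) * exp ((a - L) * x))) (at x)"
      unfolding Q_def using \<open>0 < a\<close> \<open>a < L\<close> by (auto intro!: derivative_eq_intros)
    ultimately have "(Q has_real_derivative
        \<epsilon> / a * (a * exp (a * x)) - - (exp (a * x) * exp (- L * x))) (at x)"
      by (simp only:)
    then show ?thesis
      using \<open>0 < a\<close> by (simp add: algebra_simps)
  qed
  have Q0: "\<bar>P 0\<bar> \<le> Q 0"
    using \<open>0 \<le> \<epsilon>\<close> \<open>0 < a\<close> \<open>0 \<le> g 0\<close> by (simp add: P_def Q_def \<gamma>)
  have "Q 0 - P 0 \<le> Q x - P x"
  proof (rule DERIV_nonneg_imp_nondecreasing[OF \<open>0 \<le> x\<close>])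
    fix t :: real assume "0 \<le> t"
    then show "\<exists>y. ((\<lambda>t. Q t - P t) has_real_derivative y) (at t) \<and> 0 \<le> y"
      using approx[of t]
      by (intro exI[of _ "exp (a * t) * (\<epsilon> + exp (- L * t)) - exp (a * t) * (f t - \<phi> t)"] conjI DERIV_diff P' Q')
        (simp add: right_diff_distrib[symmetric] abs_le_iff)
  qed
  moreover have "Q 0 + P 0 \<le> Q x + P x"
  proof (rule DERIV_nonneg_imp_nondecreasing[OF \<open>0 \<le> x\<close>])
    fix t :: real assume "0 \<le> t"
    then show "\<exists>y. ((\<lambda>t. Q t + P t) has_real_derivative y) (at t) \<and> 0 \<le> y"
      using approx[of t]
      by (intro exI[of _ "exp (a * t) * (\<epsilon> + exp (- L * t)) + exp (a * t) * (f t - \<phi> t)"] conjI DERIV_add P' Q')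
        (simp add: distrib_left[symmetric] abs_le_iff)
  qed
  ultimately have "\<bar>P x\<bar> \<le> Q x"
    using Q0 by linarith
  also have "Q x \<le> exp (a * x) * (g 0 + \<epsilon> / a + 1 / (L - a))"
  proof -
    have "1 * (g 0 + 1 / (L - a)) \<le> exp (a * x) * (g 0 + 1 / (L - a))"
      using assms by (intro mult_right_mono) auto
    moreover have "0 \<le> 1 / (L - a) * exp ((a - L) * x)"
      using \<open>a < L\<close> by simp
    ultimately show ?thesis
      unfolding Q_def by (simp add: algebra_simps)
  qed
  finally show ?thesis
    by (simp add: P_def abs_mult)
qed

text \<open>For large \<open>L\<close> the function \<open>exp (- exp (- L * x))\<close>
  approximates the unit step. Convolving with \<open>exp (- 2 * x)\<close> and then with
  \<open>exp (- 3 * x)\<close> gives the two closed forms.\<close>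

lemma tp_approximants:
  assumes "3 < L"
  obtains g\<^sub>1 g\<^sub>2 where "tp_function g\<^sub>1" "tp_function g\<^sub>2"
    and "\<And>x. 0 \<le> x \<Longrightarrow> \<bar>g\<^sub>1 x - (1 - exp (- 2 * x)) / 2\<bar> \<le> 3 / (L - 3)"
    and "\<And>x. 0 \<le> x \<Longrightarrow> \<bar>g\<^sub>2 x - (1 - 3 * exp (- 2 * x) + 2 * exp (- 3 * x)) / 6\<bar> \<le> 3 / (L - 3)"
proof -
  define f where "f x = exp (- exp (- L * x))" for x
  have tp: "tp_function f" unfolding f_def by (rule tp_function_gumbel) (use assms in simp)
  have cont: "isCont f x" for x unfolding f_def by (intro continuous_intros)
  have f_nonneg: "0 \<le> f x" for x by (simp add: f_def)
  \<comment> \<open>Growth bound for the convolutions, from \<open>t \<le> exp t\<close> at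
    \<open>t = exp (- L * x)\<close>.\<close>
  have f_le: "f x \<le> 1 * exp (L * x)" for x
  proof -
    have "exp (- L * x) \<le> exp (exp (- L * x))"
      using exp_ge_add_one_self[of "exp (- L * x)"] by linarith
    then show ?thesis by (simp add: f_def exp_minus field_simps)
  qed
  have f_approx: "\<bar>f x - 1\<bar> \<le> 0 + exp (- L * x)" for x
    using exp_ge_add_one_self[of "- exp (- L * x)"] by (simp add: f_def)
  obtain g\<^sub>1 where g1: "tp_function g\<^sub>1" "\<And>x. (g\<^sub>1 has_real_derivative f x - 2 * g\<^sub>1 x) (at x)"
    "\<And>x. 0 \<le> g\<^sub>1 x" "\<And>x. g\<^sub>1 x \<le> 1 / (L + 2) * exp (L * x)"
    using tp_convolution_exists[OF tp cont f_nonneg f_le, of 2] assms by auto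
  obtain g\<^sub>2 where g2: "tp_function g\<^sub>2" "\<And>x. (g\<^sub>2 has_real_derivative g\<^sub>1 x - 3 * g\<^sub>2 x) (at x)"
    "\<And>x. 0 \<le> g\<^sub>2 x" "\<And>x. g\<^sub>2 x \<le> 1 / (L + 2) / (L + 3) * exp (L * x)"
    using tp_convolution_exists[OF g1(1) DERIV_isCont[OF g1(2)] g1(3,4), of 3] assms by auto
  have approx1: "\<bar>g\<^sub>1 x - (1 - exp (- 2 * x)) / 2\<bar> \<le> g\<^sub>1 0 + 0 / 2 + 1 / (L - 2)" if "0 \<le> x" for x
  proof (rule convolution_approximation[where f = f and \<phi> = "\<lambda>_. 1"])
    fix x show "((\<lambda>x. (1 - exp (- 2 * x)) / 2) has_real_derivative
        1 - 2 * ((1 - exp (- 2 * x)) / 2)) (at x)"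
      by (auto intro!: derivative_eq_intros simp: diff_divide_distrib)
    show "\<bar>f x - 1\<bar> \<le> 0 + exp (- L * x)" by (rule f_approx)
  qed (use g1(2) g1(3)[of 0] assms that in auto)
  have small: "g\<^sub>1 0 \<le> 1 / (L - 3)" "1 / (L - 2) \<le> 1 / (L - 3)" "g\<^sub>2 0 \<le> 1 / (L - 3)"
  proof -
    have "1 / (L + 2) \<le> 1 / (L - 3)" "1 / (L - 2) \<le> 1 / (L - 3)" "1 / (L + 2) / (L + 3) \<le> 1 / (L + 2)"
      using assms by (auto intro!: divide_left_mono simp: divide_simps)
    then show "g\<^sub>1 0 \<le> 1 / (L - 3)" "1 / (L - 2) \<le> 1 / (L - 3)" "g\<^sub>2 0 \<le> 1 / (L - 3)"
      using g1(4)[of 0] g2(4)[of 0] by simp_all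
  qed
  \<comment> \<open>The uniform error of the first convolution is the input error of the
    second.\<close>
  define \<epsilon> where "\<epsilon> = g\<^sub>1 0 + 0 / 2 + 1 / (L - 2)"
  have \<epsilon>: "0 \<le> \<epsilon>" "\<epsilon> \<le> 2 / (L - 3)"
    using small g1(3)[of 0] assms by (auto simp: \<epsilon>_def)
  have approx2: "\<bar>g\<^sub>2 x - (1 - 3 * exp (- 2 * x) + 2 * exp (- 3 * x)) / 6\<bar> \<le> g\<^sub>2 0 + \<epsilon> / 3 + 1 / (L - 3)"
    if "0 \<le> x" for x
  proof (rule convolution_approximation[where f = g\<^sub>1 and \<phi> = "\<lambda>x. (1 - exp (- 2 * x)) / 2"])
    fix x :: real assume "0 \<le> x"
    then show "\<bar>g\<^sub>1 x - (1 - exp (- 2 * x)) / 2\<bar> \<le> \<epsilon> + exp (- L * x)"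
      using approx1[of x] by (simp add: \<epsilon>_def add_increasing2)
  next
    fix x show "((\<lambda>x. (1 - 3 * exp (- 2 * x) + 2 * exp (- 3 * x)) / 6) has_real_derivative
        (1 - exp (- 2 * x)) / 2 - 3 * ((1 - 3 * exp (- 2 * x) + 2 * exp (- 3 * x)) / 6)) (at x)"
      by (auto intro!: derivative_eq_intros simp: algebra_simps add_divide_distrib diff_divide_distrib)
  qed (use g2(2) g2(3)[of 0] \<epsilon> assms that in auto)
  show thesis
  proof (rule that[OF g1(1) g2(1)])
    fix x :: real assume x: "0 \<le> x"
    have "0 \<le> 1 / (L - 3)" using assms by simp
    then have "\<epsilon> \<le> 3 * (1 / (L - 3))" "g\<^sub>2 0 + \<epsilon> / 3 + 1 / (L - 3) \<le> 3 * (1 / (L - 3))"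
      using \<epsilon>(2) small(3) by linarith+
    with approx1[OF x] approx2[OF x]
    show "\<bar>g\<^sub>1 x - (1 - exp (- 2 * x)) / 2\<bar> \<le> 3 / (L - 3)"
      "\<bar>g\<^sub>2 x - (1 - 3 * exp (- 2 * x) + 2 * exp (- 3 * x)) / 6\<bar> \<le> 3 / (L - 3)"
      by (auto simp: \<epsilon>_def)
  qed
qed

section \<open>Minors of order three and four\<close>

lemma det_mat_Suc:
  fixes A :: "nat \<Rightarrow> nat \<Rightarrow> 'a :: comm_ring_1"
  shows "det (mat (Suc n) (Suc n) (\<lambda>(i, j). A i j)) =
    (\<Sum>i<Suc n. (-1) ^ i * A i 0 *
       det (mat n n (\<lambda>(k, j). A (if k < i then k else Suc k) (Suc j))))"
proof -
  let ?A = "mat (Suc n) (Suc n) (\<lambda>(i, j). A i j)"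
  have "det ?A = (\<Sum>i<Suc n. ?A $$ (i, 0) * cofactor ?A i 0)"
    by (rule laplace_expansion_column) auto
  also have "\<dots> = (\<Sum>i<Suc n. (-1) ^ i * A i 0 *
       det (mat n n (\<lambda>(k, j). A (if k < i then k else Suc k) (Suc j))))"
  proof (rule sum.cong)
    fix i assume "i \<in> {..<Suc n}"
    moreover have "mat_delete ?A i 0 = mat n n (\<lambda>(k, j). A (if k < i then k else Suc k) (Suc j))"
      unfolding mat_delete_def by (rule eq_matI) auto
    ultimately show "?A $$ (i, 0) * cofactor ?A i 0 = (-1) ^ i * A i 0 *
        det (mat n n (\<lambda>(k, j). A (if k < i then k else Suc k) (Suc j)))"
      by (simp add: cofactor_def)
  qed simp
  finally show ?thesis .
qed

lemma det_mat_2: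
  "det (mat 2 2 (\<lambda>(i, j). A i j)) = A 0 0 * A 1 1 - A 0 1 * (A 1 0 :: 'a :: comm_ring_1)"
  by (simp add: numeral_2_eq_2 det_mat_Suc algebra_simps)

definition det\<^sub>3 :: "(nat \<Rightarrow> nat \<Rightarrow> 'a :: comm_ring_1) \<Rightarrow> 'a" where
  "det\<^sub>3 A = A 0 0 * (A 1 1 * A 2 2 - A 1 2 * A 2 1) - A 1 0 * (A 0 1 * A 2 2 - A 0 2 * A 2 1)
    + A 2 0 * (A 0 1 * A 1 2 - A 0 2 * A 1 1)"

lemma det_mat_3: "det (mat 3 3 (\<lambda>(i, j). A i j)) = det\<^sub>3 A"
  by (simp add: numeral_3_eq_3 numeral_2_eq_2 det_mat_Suc det\<^sub>3_def algebra_simps)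

lemma det_mat_4:
  "det (mat 4 4 (\<lambda>(i, j). A i j)) =
    A 0 0 * det\<^sub>3 (\<lambda>i j. A (Suc i) (Suc j))
    - A 1 0 * det\<^sub>3 (\<lambda>i j. A (if i = 0 then 0 else Suc i) (Suc j))
    + A 2 0 * det\<^sub>3 (\<lambda>i j. A (if i < 2 then i else Suc i) (Suc j))
    - A 3 0 * det\<^sub>3 (\<lambda>i j. A i (Suc j))"
proof -
  have "(4 :: nat) = Suc 3" by simp
  show ?thesis
    unfolding \<open>4 = Suc 3\<close> det_mat_Suc det_mat_3
    by (simp add: eval_nat_numeral det\<^sub>3_def)
qed

lemma tendsto_det:
  fixes A :: "'b \<Rightarrow> nat \<Rightarrow> nat \<Rightarrow> real"
  assumes "\<And>i j. i < n \<Longrightarrow> j < n \<Longrightarrow> ((\<lambda>m. A m i j) \<longlongrightarrow> B i j) G"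
  shows "((\<lambda>m. det (mat n n (\<lambda>(i, j). A m i j))) \<longlongrightarrow> det (mat n n (\<lambda>(i, j). B i j))) G"
proof -
  have in_range: "i < n \<Longrightarrow> p permutes {0..<n} \<Longrightarrow> p i < n" for p and i :: nat
    using permutes_in_image[of p "{0..<n}" i] by auto
  have det: "det (mat n n (\<lambda>(i, j). D i j)) =
      (\<Sum>p | p permutes {0..<n}. signof p * (\<Prod>i = 0..<n. D i (p i)))" for D :: "nat \<Rightarrow> nat \<Rightarrow> real"
    by (subst det_def'[where n = n]) (auto simp: in_range intro!: sum.cong prod.cong)
  show ?thesis
    unfolding det by (intro tendsto_intros assms) (auto simp: in_range)
qed

section \<open>Log-concavity and limits of minors\<close>

text \<open>Log-concavity makes the ratios of successive terms decrease.\<close>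

lemma log_concave_sequence_le:
  fixes b :: "nat \<Rightarrow> real"
  assumes pos: "\<And>k. 0 < b k" and lc: "\<And>k. b k * b (k + 2) \<le> (b (k + 1))\<^sup>2"
  shows "b n \<le> b 0 * (b 1 / b 0) ^ n"
proof -
  have ratio: "b (Suc k) / b k \<le> b 1 / b 0" for k
  proof (induction k)
    case (Suc k)
    have "b (Suc (Suc k)) / b (Suc k) \<le> b (Suc k) / b k"
      using lc[of k] pos[of k] pos[of "Suc k"] by (simp add: divide_simps power2_eq_square mult.commute)
    with Suc show ?case by linarith
  qed simp
  show ?thesis
  proof (induction n)
    case (Suc n)
    have "b (Suc n) = b n * (b (Suc n) / b n)" using pos[of n] by simp
    also have "\<dots> \<le> (b 0 * (b 1 / b 0) ^ n) * (b 1 / b 0)"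
      using pos by (intro mult_mono Suc ratio) (auto intro!: mult_nonneg_nonneg zero_le_power simp: less_imp_le)
    finally show ?case by (simp add: mult_ac)
  qed simp
qed

text \<open>A drop from \<open>x\<close> to \<open>y\<close> would force geometric decay along the
  progression with step \<open>y - x\<close>, against the lower bound.\<close>

lemma log_concave_bounded_below_mono:
  fixes W :: "real \<Rightarrow> real"
  assumes pos: "\<And>x. 0 < x \<Longrightarrow> 0 < W x"
    and lc: "\<And>z d. 0 < d \<Longrightarrow> d < z \<Longrightarrow> W (z - d) * W (z + d) \<le> (W z)\<^sup>2"
    and lower: "0 < c" "eventually (\<lambda>x. c \<le> W x) at_top"
    and xy: "0 < x" "x < y"
  shows "W x \<le> W y"
proof (rule ccontr)
  assume "\<not> W x \<le> W y"
  define b where "b k = W (x + real k * (y - x))" for k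
  have b_pos: "0 < b k" for k
    unfolding b_def using xy by (intro pos add_pos_nonneg) auto
  have "b k * b (k + 2) \<le> (b (k + 1))\<^sup>2" for k
  proof -
    have "y - x < x + real (k + 1) * (y - x)"
      using mult_nonneg_nonneg[of "real k" "y - x"] xy by (simp add: algebra_simps)
    from lc[OF _ this] show ?thesis
      using xy by (simp add: b_def algebra_simps)
  qed
  from log_concave_sequence_le[of b, OF b_pos this]
  have le: "b n \<le> b 0 * (b 1 / b 0) ^ n" for n .
  have "b 1 / b 0 < 1" using \<open>\<not> W x \<le> W y\<close> b_pos[of 0] by (simp add: b_def)
  then have "(\<lambda>n. b 0 * (b 1 / b 0) ^ n) \<longlonglongrightarrow> b 0 * 0"
    using b_pos[of 0] b_pos[of 1] by (intro tendsto_intros LIMSEQ_power_zero) simp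
  moreover have "eventually (\<lambda>n. c \<le> b 0 * (b 1 / b 0) ^ n) sequentially"
  proof -
    have "filterlim (\<lambda>n. x + real n * (y - x)) at_top sequentially"
      using xy by real_asymp
    from eventually_compose_filterlim[OF lower(2) this]
    have "eventually (\<lambda>n. c \<le> b n) sequentially"
      by (simp add: b_def)
    then show ?thesis
      by eventually_elim (use le in \<open>force intro: order_trans\<close>)
  qed
  ultimately have "c \<le> b 0 * 0"
    by (rule tendsto_lowerbound) simp
  with lower(1) show False by simp
qed

text \<open>As \<open>N\<close> grows, the last row and the first column of these matrices recede to \<open>\<infinity>\<close>.\<close>

definition nonneg_minors :: "(real \<Rightarrow> real) \<Rightarrow> bool" where
  "nonneg_minors \<Phi> \<longleftrightarrow> (\<forall>z d N. 0 < d \<longrightarrow> d < z \<longrightarrow> 2 \<le> N \<longrightarrow>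
     0 \<le> det (mat 3 3 (\<lambda>(i, j). \<Phi> (z + d * (real ([N, N + 1, 2 * N] ! i) - real ([0, N, N + 1] ! j))))))"

text \<open>In the limit the last row and the first column are constantly \<open>P\<close>.
  Eliminating them leaves \<open>P\<close> times a minor of order two of
  \<open>P - \<Phi> x\<close>, with arguments \<open>z\<close>, \<open>z - d\<close>,
  \<open>z + d\<close>, \<open>z\<close>.\<close>

lemma nonneg_minors_imp_log_concave:
  assumes \<Phi>: "nonneg_minors \<Phi>" and lim: "(\<Phi> \<longlongrightarrow> P) at_top" and "0 < P"
    and d: "0 < d" "d < z"
  shows "(P - \<Phi> (z - d)) * (P - \<Phi> (z + d)) \<le> (P - \<Phi> z)\<^sup>2"
proof -
  define A where "A N i j = \<Phi> (z + d * (real ([N, N + 1, 2 * N] ! i) - real ([0, N, N + 1] ! j)))" for N i j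
  have flim: "((\<lambda>N. \<Phi> (h N)) \<longlongrightarrow> P) sequentially" if "filterlim h at_top sequentially" for h
    by (rule filterlim_compose[OF lim that])
  have less3: "i < 3 \<longleftrightarrow> i = 0 \<or> i = 1 \<or> i = (2 :: nat)" for i by auto
  let ?B = "\<lambda>i j. if j = 0 \<or> i = 2 then P else \<Phi> (z + d * (real i + 1 - real j))"
  have "((\<lambda>N. det (mat 3 3 (\<lambda>(i, j). A N i j))) \<longlongrightarrow> det (mat 3 3 (\<lambda>(i, j). ?B i j))) sequentially"
  proof (rule tendsto_det)
    fix i j :: nat assume "i < 3" "j < 3"
    show "((\<lambda>N. A N i j) \<longlongrightarrow> ?B i j) sequentially"
    proof (cases "j = 0 \<or> i = 2")
      case True
      have "filterlim (\<lambda>N. z + d * (real ([N, N + 1, 2 * N] ! i) - real ([0, N, N + 1] ! j))) at_top sequentially"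
        using True \<open>i < 3\<close> \<open>j < 3\<close> d unfolding less3
        by (elim disjE) (simp_all, real_asymp+)
      then show ?thesis using flim True by (simp add: A_def)
    next
      case False
      then have "A N i j = ?B i j" for N
        using \<open>i < 3\<close> \<open>j < 3\<close> unfolding less3 by (auto simp: A_def algebra_simps)
      then show ?thesis by simp
    qed
  qed
  moreover have "eventually (\<lambda>N. 0 \<le> det (mat 3 3 (\<lambda>(i, j). A N i j))) sequentially"
    using eventually_ge_at_top[of 2]
    by eventually_elim (use \<Phi> d in \<open>auto simp: nonneg_minors_def A_def\<close>)
  ultimately have "0 \<le> det (mat 3 3 (\<lambda>(i, j). ?B i j))"
    by (rule tendsto_lowerbound) simp
  also have "\<dots> = P * ((P - \<Phi> z)\<^sup>2 - (P - \<Phi> (z - d)) * (P - \<Phi> (z + d)))"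
    unfolding det_mat_3 by (simp add: det\<^sub>3_def power2_eq_square algebra_simps)
  finally show ?thesis using \<open>0 < P\<close> by (simp add: zero_le_mult_iff)
qed

lemma nonneg_minors_exp_mult:
  assumes "nonneg_minors D"
  shows "nonneg_minors (\<lambda>x. exp (a * x) * D x)"
  unfolding nonneg_minors_def
proof (intro allI impI)
  fix z d :: real and N :: nat
  assume "0 < d" "d < z" "2 \<le> N"
  define k where "k i = real ([N, N + 1, 2 * N] ! i)" for i
  define l where "l j = real ([0, N, N + 1] ! j)" for j
  have "0 \<le> det (mat 3 3 (\<lambda>(i, j). D (z + d * (k i - l j))))"
    using assms \<open>0 < d\<close> \<open>d < z\<close> \<open>2 \<le> N\<close> by (simp add: nonneg_minors_def k_def l_def)
  then have "0 \<le> (\<Prod>i<3. exp (a * (z + d * k i))) * (\<Prod>j<3. exp (- a * d * l j)) *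
      det (mat 3 3 (\<lambda>(i, j). D (z + d * (k i - l j))))"
    by (intro mult_nonneg_nonneg prod_nonneg) auto
  also have "\<dots> = det (mat 3 3 (\<lambda>(i, j). exp (a * (z + d * (k i - l j))) * D (z + d * (k i - l j))))"
    unfolding det_scale[symmetric]
    by (rule det_mat_cong) (simp add: exp_add[symmetric] algebra_simps)
  finally show "0 \<le> det (mat 3 3 (\<lambda>(i, j).
      exp (a * (z + d * (real ([N, N + 1, 2 * N] ! i) - real ([0, N, N + 1] ! j)))) *
      D (z + d * (real ([N, N + 1, 2 * N] ! i) - real ([0, N, N + 1] ! j)))))"
    by (simp add: k_def l_def)
qed

text \<open>For fixed \<open>N\<close> and growing \<open>M\<close> the last row and the first
  column tend to \<open>P\<close>, and elimination leaves \<open>P\<close> times a minor of order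
  three. The inner indices differ as in \<open>nonneg_minors\<close>, so a further limit in
  \<open>N\<close> remains possible.\<close>

lemma nonneg_minors_reduce:
  assumes \<Phi>: "\<And>z d M N. 0 < d \<Longrightarrow> d < z \<Longrightarrow> 2 \<le> N \<Longrightarrow> 2 * N < M \<Longrightarrow>
      0 \<le> det (mat 4 4 (\<lambda>(i, j). \<Phi> (z + d * (real ([M, M + 1, M + N, 2 * M] ! i) - real ([0, M - N, M, M + 1] ! j)))))"
    and lim: "(\<Phi> \<longlongrightarrow> P) at_top" and "0 < P"
  shows "nonneg_minors (\<lambda>x. P - \<Phi> x)"
  unfolding nonneg_minors_def
proof (intro allI impI)
  fix z d :: real and N :: nat
  assume d: "0 < d" "d < z" and N: "2 \<le> N"
  define A where "A M i j = \<Phi> (z + d * (real ([M, M + 1, M + N, 2 * M] ! i) - real ([0, M - N, M, M + 1] ! j)))" for M i j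
  define C where "C i j = z + d * (real ([N, N + 1, 2 * N] ! i) - real ([0, N, N + 1] ! j))" for i j
  let ?B = "\<lambda>i j. if j = 0 \<or> i = 3 then P else \<Phi> (C i (j - 1))"
  have less4: "i < 4 \<longleftrightarrow> i = 0 \<or> i = 1 \<or> i = 2 \<or> i = (3 :: nat)" for i by auto
  have "((\<lambda>M. det (mat 4 4 (\<lambda>(i, j). A M i j))) \<longlongrightarrow> det (mat 4 4 (\<lambda>(i, j). ?B i j))) sequentially"
  proof (rule tendsto_det)
    fix i j :: nat assume "i < 4" "j < 4"
    show "((\<lambda>M. A M i j) \<longlongrightarrow> ?B i j) sequentially"
    proof (cases "j = 0 \<or> i = 3")
      case True
      have "filterlim (\<lambda>M. z + d * (real ([M, M + 1, M + N, 2 * M] ! i) - real ([0, M - N, M, M + 1] ! j))) at_top sequentially"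
      \<comment> \<open>The smallest index difference occurs in the last row and column:
        \<open>2 * M - (M + 1) = M - 1\<close>.\<close>
      proof (rule filterlim_at_top_mono)
        show "filterlim (\<lambda>M. z + d * (real M - 1)) at_top sequentially"
          using d by real_asymp
        show "\<forall>\<^sub>F M in sequentially. z + d * (real M - 1) \<le>
            z + d * (real ([M, M + 1, M + N, 2 * M] ! i) - real ([0, M - N, M, M + 1] ! j))"
          using True \<open>i < 4\<close> \<open>j < 4\<close> d unfolding less4
          by (auto simp: numeral_3_eq_3 intro!: always_eventually)
      qed
      then show ?thesis
        using filterlim_compose[OF lim] True by (simp add: A_def)
    next
      case False
      then have ij: "i = 0 \<or> i = 1 \<or> i = 2" "j = 1 \<or> j = 2 \<or> j = 3"
        using \<open>i < 4\<close> \<open>j < 4\<close> by auto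
      \<comment> \<open>The natural subtraction \<open>M - N\<close> is exact once
        \<open>N \<le> M\<close>.\<close>
      have "eventually (\<lambda>M. A M i j = ?B i j) sequentially"
        using eventually_ge_at_top[of N]
        by eventually_elim (use ij in \<open>auto simp: A_def C_def of_nat_diff\<close>)
      then show ?thesis by (rule tendsto_eventually)
    qed
  qed
  moreover have "eventually (\<lambda>M. 0 \<le> det (mat 4 4 (\<lambda>(i, j). A M i j))) sequentially"
    using eventually_gt_at_top[of "2 * N"]
    by eventually_elim (unfold A_def, rule \<Phi>[OF d N])
  ultimately have "0 \<le> det (mat 4 4 (\<lambda>(i, j). ?B i j))"
    by (rule tendsto_lowerbound) simp
  also have "\<dots> = P * det (mat 3 3 (\<lambda>(i, j). P - \<Phi> (C i j)))"
    unfolding det_mat_4 det_mat_3 by (simp add: det\<^sub>3_def numeral_2_eq_2[symmetric] algebra_simps)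
  finally show "0 \<le> det (mat 3 3 (\<lambda>(i, j). P - \<Phi> (z + d * (real ([N, N + 1, 2 * N] ! i) - real ([0, N, N + 1] ! j)))))"
    using \<open>0 < P\<close> by (simp add: zero_le_mult_iff C_def)
qed

section \<open>Preservers\<close>

text \<open>What is retained of the kernels on \<open>X\<close> and \<open>Y\<close>: minors on
  integer grids, with arbitrary shift \<open>c\<close> and spacing \<open>d\<close>.\<close>

locale tp_preserver =
  fixes F :: "real \<Rightarrow> real"
  assumes F_pos: "0 < t \<Longrightarrow> 0 < F t"
    and F_det_pos: "tp_function f \<Longrightarrow> strict_mono_on {..<n} k \<Longrightarrow> strict_mono_on {..<n} l \<Longrightarrow> 0 < d \<Longrightarrow>
      0 < det (mat n n (\<lambda>(i, j). F (f (c + d * (real (k i) - real (l j))))))"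

text \<open>A long common progression is an affine copy of an integer grid. Rescaling
  \<open>f\<close> accordingly gives a totally positive Toeplitz kernel on all of \<open>X\<close>
  and \<open>Y\<close> whose minors on the progression are those of \<open>f\<close> on the
  grid.\<close>

lemma admissible_imp_tp_preserver:
  assumes adm: "admissible X Y" and pos: "\<And>t. 0 < t \<Longrightarrow> 0 < F t"
    and pres: "\<And>K. toeplitz_kernel X Y K \<Longrightarrow> totally_positive X Y K \<Longrightarrow>
      totally_positive X Y (\<lambda>x y. F (K x y))"
  shows "tp_preserver F"
proof
  fix t :: real assume "0 < t" then show "0 < F t" by (rule pos)
next
  fix f :: "real \<Rightarrow> real" and n and k l :: "nat \<Rightarrow> nat" and c d :: real
  assume f: "tp_function f" and k: "strict_mono_on {..<n} k" and l: "strict_mono_on {..<n} l"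
    and d: "0 < d"
  show "0 < det (mat n n (\<lambda>(i, j). F (f (c + d * (real (k i) - real (l j))))))"
  proof (cases "n = 0")
    case False
    \<comment> \<open>The sums dominate every index; the summand 2 makes \<open>admissible\<close>
      applicable and the inequalities strict.\<close>
    define N where "N = 2 + sum k {..<n} + sum l {..<n}"
    have kN: "k i < N" if "i < n" for i
      using member_le_sum[of i "{..<n}" k] that by (simp add: N_def)
    have lN: "l i < N" if "i < n" for i
      using member_le_sum[of i "{..<n}" l] that by (simp add: N_def)
    have "2 \<le> N" by (simp add: N_def)
    then obtain x y where x: "increasing_tuple N X x" and y: "increasing_tuple N Y y"
      and step: "\<And>j. Suc j < N \<Longrightarrow> x (Suc j) - x j = x 1 - x 0 \<and> y (Suc j) - y j = x 1 - x 0"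
      using adm unfolding admissible_def by blast
    define h where "h = x 1 - x 0"
    have h: "0 < h"
      using x \<open>2 \<le> N\<close> by (auto simp: h_def increasing_tuple_def strict_mono_on_def)
    have step: "x (Suc j) = x j + h" "y (Suc j) = y j + h" if "Suc j < N" for j
      using step[OF that] by (simp_all add: h_def)
    have x_eq: "j < N \<Longrightarrow> x j = x 0 + real j * h" for j
    proof (induction j)
      case (Suc j) then show ?case using step[of j] by (simp add: algebra_simps)
    qed simp
    have y_eq: "j < N \<Longrightarrow> y j = y 0 + real j * h" for j
    proof (induction j)
      case (Suc j) then show ?case using step[of j] by (simp add: algebra_simps)
    qed simp
    \<comment> \<open>The affine map sends the offset \<open>x 0 - y 0\<close> to \<open>c\<close>
      and the common step \<open>h\<close> to \<open>d\<close>.\<close>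
    define K where "K u v = f (c + d / h * ((u - v) - (x 0 - y 0)))" for u v
    have "toeplitz_kernel X Y K"
      unfolding toeplitz_kernel_def K_def
      by (rule exI[of _ "\<lambda>t. f (c + d / h * (t - (x 0 - y 0)))"]) simp
    moreover have "totally_positive X Y K"
      unfolding totally_positive_def
    proof (intro allI impI)
      fix m u v assume "increasing_tuple m X u" "increasing_tuple m Y v"
      then have "strict_mono_on {..<m} (\<lambda>i. c + d / h * (u i - x 0))"
        "strict_mono_on {..<m} (\<lambda>j. d / h * (v j - y 0))"
        using d h by (auto simp: increasing_tuple_def strict_mono_on_def intro!: divide_strict_right_mono)
      from tp_functionD[OF f this] show "0 < det (mat m m (\<lambda>(i, j). K (u i) (v j)))"
        by (simp add: K_def algebra_simps)
    qed
    ultimately have "totally_positive X Y (\<lambda>u v. F (K u v))" by (rule pres)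
    moreover have "increasing_tuple n X (x \<circ> k)" "increasing_tuple n Y (y \<circ> l)"
      using x y k l kN lN by (auto simp: increasing_tuple_def strict_mono_on_def image_subset_iff)
    ultimately have "0 < det (mat n n (\<lambda>(i, j). F (K ((x \<circ> k) i) ((y \<circ> l) j))))"
      using False unfolding totally_positive_def by (metis One_nat_def Suc_leI neq0_conv)
    also have "\<dots> = det (mat n n (\<lambda>(i, j). F (f (c + d * (real (k i) - real (l j))))))"
    proof (rule det_mat_cong)
      fix i j assume "i < n" "j < n"
      then have "x (k i) - y (l j) - (x 0 - y 0) = h * (real (k i) - real (l j))"
        by (simp add: x_eq[OF kN] y_eq[OF lN] algebra_simps)
      then show "F (K ((x \<circ> k) i) ((y \<circ> l) j)) = F (f (c + d * (real (k i) - real (l j))))"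
        using h by (simp add: K_def)
    qed
    finally show ?thesis .
  qed simp
qed

section \<open>Monotonicity, continuity and multiplicative concavity\<close>

context tp_preserver
begin

text \<open>A scaled Gaussian takes the values \<open>r\<close>, \<open>q\<close>, \<open>p\<close>
  at -1, 0, 1; its parameter \<open>\<beta>\<close> is positive because
  \<open>p * r < q\<^sup>2\<close>. The claim is a minor of order two.\<close>

lemma F_mid_strict:
  assumes "0 < p" "0 < q" "0 < r" "p * r < q\<^sup>2"
  shows "F p * F r < (F q)\<^sup>2"
proof -
  define \<beta> where "\<beta> = ln q - (ln p + ln r) / 2"
  define \<gamma> where "\<gamma> = (ln p - ln r) / 2"
  have "ln (p * r) < ln (q\<^sup>2)" using assms by (subst ln_less_cancel_iff) auto
  then have "0 < \<beta>" using assms by (simp add: \<beta>_def ln_mult ln_realpow)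
  define f where "f x = q * exp (\<gamma> * x - \<beta> * x\<^sup>2)" for x
  have tp: "tp_function f"
    unfolding f_def by (intro tp_function_scale tp_function_gaussian \<open>0 < \<beta>\<close> \<open>0 < q\<close>)
  have "\<gamma> - \<beta> = ln p - ln q" "- \<gamma> - \<beta> = ln r - ln q"
    by (simp_all add: \<beta>_def \<gamma>_def field_simps)
  then have f: "f 0 = q" "f 1 = p" "f (-1) = r"
    using assms by (simp_all add: f_def exp_diff)
  have "strict_mono_on {..<2} (\<lambda>i::nat. i)" by (simp add: strict_mono_on_def)
  from F_det_pos[OF tp this this, of 1 0] have "0 < det (mat 2 2 (\<lambda>(i, j). F (f (real i - real j))))"
    by simp
  then show ?thesis
    unfolding det_mat_2 by (simp add: f power2_eq_square mult.commute)
qed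

lemma F_less:
  assumes "0 < p" "p < q"
  shows "F p < F q"
proof -
  have "p * p < q\<^sup>2" using assms by (simp add: power2_eq_square mult_strict_mono)
  then have "(F p)\<^sup>2 < (F q)\<^sup>2"
    using F_mid_strict[of p q p] assms by (simp add: power2_eq_square)
  then show ?thesis
    using F_pos[of q] assms by (auto intro: power2_less_imp_less)
qed

lemma F_le: "0 < p \<Longrightarrow> p \<le> q \<Longrightarrow> F p \<le> F q"
  using F_less[of p q] by (cases "p = q") auto

text \<open>A jump of \<open>F\<close> at \<open>a\<close> is impossible: \<open>F_mid_strict\<close> applies to two points to the left of \<open>a\<close>
  and one point to its right.\<close>

lemma F_isCont:
  assumes "0 < a"
  shows "isCont F a"
proof -
  \<comment> \<open>\<open>U\<close> and \<open>V\<close> are the limits of the increasing function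
    \<open>F\<close> at \<open>a\<close> from the right and from the left.\<close>
  define U where "U = Inf (F ` {a<..})"
  define V where "V = Sup (F ` {0<..<a})"
  have bdd: "bdd_below (F ` {a<..})" "bdd_above (F ` {0<..<a})"
    using F_le assms by (auto intro!: bdd_belowI2[of _ "F a"] bdd_aboveI2[of _ _ "F a"])
  have U: "U \<le> F s" if "a < s" for s
    unfolding U_def using bdd that by (auto intro!: cInf_lower)
  have V: "F s \<le> V" if "0 < s" "s < a" for s
    unfolding V_def using bdd that by (auto intro!: cSup_upper)
  have "V \<le> F a" unfolding V_def using F_le assms by (intro cSUP_least) auto
  have "F a \<le> U" unfolding U_def using F_le assms by (intro cINF_greatest) auto
  have V_approx: "\<exists>s. 0 < s \<and> s < a \<and> v < F s" if "v < V" for v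
    using less_cSupD[of "F ` {0<..<a}" v] that assms by (auto simp: V_def)
  have U_approx: "\<exists>s>a. F s < u" if "U < u" for u
    using cInf_lessD[of "F ` {a<..}" u] that by (auto simp: U_def)
  have "0 < V" using V[of "a / 2"] F_pos[of "a / 2"] assms by linarith
  have "0 < U" using \<open>F a \<le> U\<close> F_pos[OF assms] by linarith
  have "U \<le> V"
  proof (rule ccontr)
    assume "\<not> U \<le> V"
    \<comment> \<open>A gap yields a point \<open>s\<close> left of \<open>a\<close> with
      \<open>F s * U > V\<^sup>2\<close>.\<close>
    then have "V\<^sup>2 / U < V" using \<open>0 < V\<close> \<open>0 < U\<close> by (simp add: power2_eq_square divide_simps)
    then obtain s where s: "0 < s" "s < a" "V\<^sup>2 / U < F s" using V_approx by blast
    define t where "t = a / s"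
    have t: "1 < t" "a = s * t" using s by (auto simp: t_def)
    \<comment> \<open>Now \<open>a = s * w ^ 4\<close> lies between \<open>m = s * w ^ 3\<close> and
      \<open>p = s * w ^ 5\<close>, while \<open>s * p < m\<^sup>2\<close> because 5 < 6.\<close>
    define w where "w = root 4 t"
    have w: "1 < w" "t = w ^ 4" using t by (auto simp: w_def)
    define m where "m = s * w ^ 3"
    define p where "p = s * w ^ 5"
    have "w ^ 3 < w ^ 4" "w ^ 4 < w ^ 5" "w ^ 5 < w ^ 6" using w by (auto intro!: power_strict_increasing)
    then have "m < a" "a < p" "s * p < m\<^sup>2" "0 < m"
      using s w t by (auto simp: m_def p_def power_mult_distrib power2_eq_square
          mult.assoc simp flip: power_add intro!: mult_strict_left_mono)
    then have "F s * F p < (F m)\<^sup>2" using F_mid_strict[of s m p] s by auto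
    also have "\<dots> \<le> V\<^sup>2" using V[of m] \<open>m < a\<close> \<open>0 < m\<close> F_pos[of m] by (intro power_mono) auto
    also have "\<dots> < F s * U" using s \<open>0 < U\<close> by (simp add: divide_simps)
    also have "\<dots> \<le> F s * F p" using U[OF \<open>a < p\<close>] F_pos[OF s(1)] by (intro mult_left_mono) auto
    finally show False by simp
  qed
  with \<open>V \<le> F a\<close> \<open>F a \<le> U\<close> have eq: "U = F a" "V = F a" by auto
  have "(F \<longlongrightarrow> F a) (at a)"
  proof (rule order_tendstoI)
    fix v assume "v < F a"
    then obtain s where s: "0 < s" "s < a" "v < F s" using V_approx eq by blast
    then have "\<forall>\<^sub>F x in at a. s < x"
      by (intro order_tendstoD(1)[OF tendsto_ident_at])
    then show "\<forall>\<^sub>F x in at a. v < F x"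
      by eventually_elim (rule less_trans[OF s(3)], rule F_less[OF s(1)])
  next
    fix v assume "F a < v"
    then obtain s where s: "a < s" "F s < v" using U_approx eq by blast
    have "\<forall>\<^sub>F x in at a. x < s" "\<forall>\<^sub>F x in at a. 0 < x"
      using s assms by (auto intro!: order_tendstoD[OF tendsto_ident_at])
    then show "\<forall>\<^sub>F x in at a. F x < v"
      by eventually_elim (rule less_trans[OF F_less s(2)])
  qed
  then show ?thesis by (simp add: isCont_def)
qed

text \<open>Raising \<open>q\<close> slightly makes the hypothesis strict; continuity then gives the
  limit case.\<close>

lemma F_mid:
  assumes "0 < p" "0 < q" "0 < r" "q\<^sup>2 = p * r"
  shows "F p * F r \<le> (F q)\<^sup>2"
proof (rule tendsto_lowerbound)
  show "((\<lambda>s. (F s)\<^sup>2) \<longlongrightarrow> (F q)\<^sup>2) (at_right q)"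
    using F_isCont[OF \<open>0 < q\<close>] by (intro tendsto_intros) (simp add: isCont_def filterlim_at_split)
  show "\<forall>\<^sub>F s in at_right q. F p * F r \<le> (F s)\<^sup>2"
    using eventually_at_right_less[of q]
  proof eventually_elim
    case (elim s)
    then have "q\<^sup>2 < s\<^sup>2" using \<open>0 < q\<close> by (intro power_strict_mono) auto
    then show ?case using F_mid_strict[of p s r] assms elim by auto
  qed
qed simp

text \<open>\<open>ln F\<close> is concave in \<open>ln t\<close>, so its positive mean slope
  \<open>\<kappa>\<close> just to the right of \<open>A\<close> bounds the slopes to the left from
  below. This supplies the lower bound needed for
  \<open>log_concave_bounded_below_mono\<close>.\<close>

lemma F_increment_lower:
  assumes A: "0 < A"
  obtains c where "0 < c" "\<And>u. 0 < u \<Longrightarrow> u < A \<Longrightarrow> c * u \<le> F A - F (A - u)"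
proof -
  define \<kappa> where "\<kappa> = ln (F (A * exp 1) / F A)"
  have "F A < F (A * exp 1)" using A by (intro F_less) auto
  then have \<kappa>: "0 < \<kappa>" using F_pos[OF A] by (simp add: \<kappa>_def)
  define c where "c = F A * \<kappa> / ((1 + \<kappa>) * (2 * A))"
  have "0 < c" using \<kappa> A F_pos[OF A] by (simp add: c_def)
  moreover have "c * u \<le> F A - F (A - u)" if u: "0 < u" "u < A" for u
  proof -
    \<comment> \<open>Steps of \<open>1 / n\<close> on the logarithmic scale:
      \<open>n \<ge> A / u\<close> makes one step back from \<open>A\<close> no longer than
      \<open>u\<close>, and \<open>n \<le> 2 * A / u\<close> keeps the bound linear in
      \<open>u\<close>.\<close>
    define n where "n = nat \<lceil>A / u\<rceil>"
    have n: "A / u \<le> real n" "real n \<le> 2 * A / u" "1 \<le> n"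
    proof -
      show "A / u \<le> real n" unfolding n_def by linarith
      have "real n \<le> A / u + 1" using A u unfolding n_def by (simp add: ceiling_correct)
      moreover have "1 \<le> A / u" using u by simp
      ultimately show "real n \<le> 2 * A / u" by simp
      then show "1 \<le> n" using \<open>1 \<le> A / u\<close> \<open>A / u \<le> real n\<close> by linarith
    qed
    \<comment> \<open>The index is shifted so that \<open>b 1\<close> is the value at
      \<open>A\<close> and \<open>b 0\<close> the value one step before it.\<close>
    define b where "b k = F (A * exp ((real k - 1) / real n))" for k
    have b_pos: "0 < b k" for k unfolding b_def using A by (intro F_pos) auto
    have "b k * b (k + 2) \<le> (b (k + 1))\<^sup>2" for k
      unfolding b_def using A n
      by (intro F_mid) (auto simp: power2_eq_square exp_add[symmetric] field_simps)
    from log_concave_sequence_le[of b, OF b_pos this, of "Suc n"]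
    have "b (Suc n) \<le> b 0 * (b 1 / b 0) ^ Suc n" .
    then have "b (Suc n) / b 1 \<le> (b 1 / b 0) ^ n"
      using b_pos[of 0] b_pos[of 1] by (simp add: divide_simps mult_ac)
    moreover have b_vals: "b (Suc n) = F (A * exp 1)" "b 1 = F A" "b 0 = F (A * exp (- 1 / real n))"
      using n by (simp_all add: b_def)
    ultimately have "exp \<kappa> \<le> (b 1 / b 0) ^ n"
      using F_pos[OF A] F_pos[of "A * exp 1"] A by (simp add: \<kappa>_def)
    then have "ln (exp \<kappa>) \<le> ln ((b 1 / b 0) ^ n)"
      using b_pos by (subst ln_le_cancel_iff) auto
    then have "\<kappa> \<le> real n * ln (b 1 / b 0)"
      using b_pos by (simp add: ln_realpow)
    also have "\<dots> \<le> real n * (b 1 / b 0 - 1)"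
      using b_pos[of 0] b_pos[of 1] by (intro mult_left_mono ln_le_minus_one) auto
    finally have "\<kappa> * b 0 \<le> real n * (b 1 - b 0)"
      using b_pos[of 0] by (simp add: field_simps)
    then have "\<kappa> * b 1 \<le> (real n + \<kappa>) * (b 1 - b 0)"
      by (simp add: algebra_simps)
    also have "\<dots> \<le> (real n * (1 + \<kappa>)) * (b 1 - b 0)"
    proof -
      have "b 0 \<le> b 1" unfolding b_vals using A by (intro F_le) auto
      moreover have "\<kappa> * 1 \<le> \<kappa> * real n" using n \<kappa> by (intro mult_left_mono) auto
      ultimately show ?thesis by (intro mult_right_mono) (auto simp: algebra_simps)
    qed
    also have "\<dots> \<le> (2 * A / u * (1 + \<kappa>)) * (b 1 - b 0)"
    proof -
      have "b 0 \<le> b 1" unfolding b_vals using A by (intro F_le) auto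
      then show ?thesis using n \<kappa> by (intro mult_right_mono) auto
    qed
    finally have "\<kappa> * b 1 * u \<le> (b 1 - b 0) * ((1 + \<kappa>) * (2 * A))"
      using u by (simp add: field_simps)
    then have "\<kappa> * b 1 * u / ((1 + \<kappa>) * (2 * A)) \<le> b 1 - b 0"
      using A \<kappa> by (subst pos_divide_le_eq) auto
    moreover have "c * u = \<kappa> * b 1 * u / ((1 + \<kappa>) * (2 * A))"
      unfolding c_def b_vals(2) by (simp add: mult_ac)
    ultimately have "c * u \<le> b 1 - b 0" by (simp only:)
    moreover have "F (A - u) \<le> b 0"
    proof -
      have "1 - u / A \<le> 1 - 1 / real n" using n A u by (simp add: field_simps)
      also have "\<dots> \<le> exp (- 1 / real n)" using exp_ge_add_one_self[of "- 1 / real n"] by simp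
      finally have "A - u \<le> A * exp (- 1 / real n)" using A by (simp add: field_simps)
      then show ?thesis unfolding b_vals using u by (intro F_le) auto
    qed
    ultimately show ?thesis unfolding b_vals by linarith
  qed
  ultimately show thesis by (rule that)
qed

text \<open>Strict positivity survives the limit only as nonnegativity. Arguments stay positive
  because convergence of \<open>f m\<close> and positivity of the limit are assumed only
  there.\<close>

lemma det_limit_nonneg:
  assumes tp: "\<And>m. tp_function (f m)" and lim: "\<And>x. 0 < x \<Longrightarrow> (\<lambda>m. f m x) \<longlonglongrightarrow> \<phi> x"
    and pos: "\<And>x. 0 < x \<Longrightarrow> 0 < \<phi> x"
    and kl: "strict_mono_on {..<n} k" "strict_mono_on {..<n} l" and d: "0 < d"
    and arg_pos: "\<And>i j. i < n \<Longrightarrow> j < n \<Longrightarrow> 0 < c + d * (real (k i) - real (l j))"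
  shows "0 \<le> det (mat n n (\<lambda>(i, j). F (\<phi> (c + d * (real (k i) - real (l j))))))"
proof (rule tendsto_lowerbound)
  show "(\<lambda>m. det (mat n n (\<lambda>(i, j). F (f m (c + d * (real (k i) - real (l j))))))) \<longlonglongrightarrow>
      det (mat n n (\<lambda>(i, j). F (\<phi> (c + d * (real (k i) - real (l j))))))"
    by (intro tendsto_det isCont_tendsto_compose[OF F_isCont] lim pos arg_pos)
  show "\<forall>\<^sub>F m in sequentially. 0 \<le> det (mat n n (\<lambda>(i, j). F (f m (c + d * (real (k i) - real (l j))))))"
    using F_det_pos[OF tp kl d] by (simp add: less_imp_le)
qed simp

end

text \<open>Taking \<open>L = m + 4\<close> makes the errors \<open>3 / (m + 1)\<close>; the factors
  \<open>2 * A\<close> and \<open>6 * A\<close> normalise the limits at infinity to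
  \<open>A\<close>.\<close>

lemma tp_limits:
  fixes A :: real
  assumes A: "0 < A"
  shows "\<exists>f :: nat \<Rightarrow> real \<Rightarrow> real. (\<forall>m. tp_function (f m)) \<and>
      (\<forall>x>0. (\<lambda>m. f m x) \<longlonglongrightarrow> A * (1 - exp (- 2 * x)))"
    and "\<exists>f :: nat \<Rightarrow> real \<Rightarrow> real. (\<forall>m. tp_function (f m)) \<and>
      (\<forall>x>0. (\<lambda>m. f m x) \<longlonglongrightarrow> A * (1 - 3 * exp (- 2 * x) + 2 * exp (- 3 * x)))"
proof -
  have "\<exists>g\<^sub>1 g\<^sub>2. tp_function g\<^sub>1 \<and> tp_function g\<^sub>2 \<and>
      (\<forall>x>0. \<bar>g\<^sub>1 x - (1 - exp (- 2 * x)) / 2\<bar> \<le> 3 / (real m + 1)) \<and>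
      (\<forall>x>0. \<bar>g\<^sub>2 x - (1 - 3 * exp (- 2 * x) + 2 * exp (- 3 * x)) / 6\<bar> \<le> 3 / (real m + 1))" for m
  proof -
    have "real m + 4 - 3 = real m + 1" by simp
    note approximants = tp_approximants[of "real m + 4", unfolded this]
    show ?thesis
    proof (rule approximants)
      show "3 < real m + 4" by simp
    qed (use less_imp_le in blast)
  qed
  then obtain g\<^sub>1 g\<^sub>2 :: "nat \<Rightarrow> real \<Rightarrow> real"
    where tp: "\<And>m. tp_function (g\<^sub>1 m)" "\<And>m. tp_function (g\<^sub>2 m)"
      and g1: "\<And>m x. 0 < x \<Longrightarrow> \<bar>g\<^sub>1 m x - (1 - exp (- 2 * x)) / 2\<bar> \<le> 3 / (real m + 1)"
      and g2: "\<And>m x. 0 < x \<Longrightarrow>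
        \<bar>g\<^sub>2 m x - (1 - 3 * exp (- 2 * x) + 2 * exp (- 3 * x)) / 6\<bar> \<le> 3 / (real m + 1)"
    by metis
  have lim: "(\<lambda>m. c * h m) \<longlonglongrightarrow> c * a" if "\<And>m. \<bar>h m - a\<bar> \<le> 3 / (real m + 1)" for h and c a :: real
  proof -
    have "(\<lambda>m. 3 / (real m + 1)) \<longlonglongrightarrow> 0" by real_asymp
    then have "(\<lambda>m. h m - a) \<longlonglongrightarrow> 0"
      by (rule Lim_null_comparison[rotated]) (use that in simp)
    then show ?thesis by (intro tendsto_intros) (simp add: LIM_zero_iff)
  qed
  show "\<exists>f :: nat \<Rightarrow> real \<Rightarrow> real. (\<forall>m. tp_function (f m)) \<and>
      (\<forall>x>0. (\<lambda>m. f m x) \<longlonglongrightarrow> A * (1 - exp (- 2 * x)))"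
    using lim[OF g1, of _ "2 * A"] A
    by (intro exI[of _ "\<lambda>m x. 2 * A * g\<^sub>1 m x"]) (simp add: tp_function_scale tp)
  show "\<exists>f :: nat \<Rightarrow> real \<Rightarrow> real. (\<forall>m. tp_function (f m)) \<and>
      (\<forall>x>0. (\<lambda>m. f m x) \<longlonglongrightarrow> A * (1 - 3 * exp (- 2 * x) + 2 * exp (- 3 * x)))"
    using lim[OF g2, of _ "6 * A"] A
    by (intro exI[of _ "\<lambda>m x. 6 * A * g\<^sub>2 m x"]) (simp add: tp_function_scale tp)
qed

section \<open>Convexity\<close>

context tp_preserver
begin

text \<open>With \<open>u = A * exp (- 2 * x)\<close>, the chord slope at \<open>A\<close> is, up to
  the factor \<open>A\<close>, the log-concave function \<open>W x\<close>. It is bounded below,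
  hence increasing in \<open>x\<close>, while \<open>u\<close> decreases.\<close>

lemma F_slope_antimono:
  assumes A: "0 < A" and uv: "0 < u" "u < v" "v < A"
  shows "(F A - F (A - v)) / v \<le> (F A - F (A - u)) / u"
proof -
  define \<phi> where "\<phi> x = A * (1 - exp (- 2 * x))" for x :: real
  have \<phi>_pos: "0 < \<phi> x" and \<phi>_less: "\<phi> x < A" if "0 < x" for x
    using A that by (simp_all add: \<phi>_def)
  obtain f where f: "\<And>m. tp_function (f m)" "\<And>x. 0 < x \<Longrightarrow> (\<lambda>m. f m x) \<longlonglongrightarrow> \<phi> x"
    using tp_limits(1)[OF A] unfolding \<phi>_def by blast
  have "nonneg_minors (\<lambda>x. F (\<phi> x))"
    unfolding nonneg_minors_def
  proof (intro allI impI)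
    fix z d :: real and N :: nat
    assume d: "0 < d" "d < z" and N: "2 \<le> N"
    have less3: "i < 3 \<longleftrightarrow> i = 0 \<or> i = 1 \<or> i = (2 :: nat)" for i by auto
    show "0 \<le> det (mat 3 3 (\<lambda>(i, j). F (\<phi> (z + d * (real ([N, N + 1, 2 * N] ! i) - real ([0, N, N + 1] ! j))))))"
    proof (rule det_limit_nonneg[where f = f])
      show "strict_mono_on {..<3} ((!) [N, N + 1, 2 * N])" "strict_mono_on {..<3} ((!) [0, N, N + 1])"
        using N by (auto simp: strict_mono_on_def less3)
      fix i j :: nat assume "i < 3" "j < 3"
      then have "- 1 \<le> real ([N, N + 1, 2 * N] ! i) - real ([0, N, N + 1] ! j)"
        using N by (auto simp: less3)
      then have "d * (- 1) \<le> d * (real ([N, N + 1, 2 * N] ! i) - real ([0, N, N + 1] ! j))"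
        using d by (intro mult_left_mono) auto
      then show "0 < z + d * (real ([N, N + 1, 2 * N] ! i) - real ([0, N, N + 1] ! j))"
        using d by simp
    qed (use f \<phi>_pos d in auto)
  qed
  moreover have "((\<lambda>x. F (\<phi> x)) \<longlongrightarrow> F A) at_top"
  proof (rule isCont_tendsto_compose[OF F_isCont[OF A]])
    show "(\<phi> \<longlongrightarrow> A) at_top" unfolding \<phi>_def by real_asymp
  qed
  ultimately have D: "(F A - F (\<phi> (z - d))) * (F A - F (\<phi> (z + d))) \<le> (F A - F (\<phi> z))\<^sup>2"
    if "0 < d" "d < z" for z d
    by (rule nonneg_minors_imp_log_concave) (use F_pos[OF A] that in auto)
  \<comment> \<open>The factor \<open>exp (2 * x)\<close> is log-linear, so it preserves
    log-concavity while compensating the decay of the increment.\<close>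
  define W where "W x = exp (2 * x) * (F A - F (\<phi> x))" for x
  obtain c where c: "0 < c" "\<And>u. 0 < u \<Longrightarrow> u < A \<Longrightarrow> c * u \<le> F A - F (A - u)"
    using F_increment_lower[OF A] by blast
  have W_ge: "c * A \<le> W x" if "0 < x" for x
  proof -
    have "exp (2 * x) * (c * (A * exp (- 2 * x))) \<le> exp (2 * x) * (F A - F (A - A * exp (- 2 * x)))"
      using A that by (intro mult_left_mono c) auto
    moreover have "exp (2 * x) * (c * (A * exp (- 2 * x))) = c * A"
      by (simp add: exp_minus)
    ultimately have "c * A \<le> exp (2 * x) * (F A - F (A - A * exp (- 2 * x)))"
      by (simp only:)
    then show ?thesis by (simp add: W_def \<phi>_def right_diff_distrib)
  qed
  have W_mono: "W x \<le> W y" if "0 < x" "x < y" for x y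
  proof (rule log_concave_bounded_below_mono[of W])
    show "0 < W x" if "0 < x" for x
      using F_less[OF \<phi>_pos \<phi>_less] that by (simp add: W_def)
    show "W (z - d) * W (z + d) \<le> (W z)\<^sup>2" if "0 < d" "d < z" for z d
    proof -
      have exp_sq: "exp (2 * (z - d)) * exp (2 * (z + d)) = (exp (2 * z))\<^sup>2"
        by (simp add: power2_eq_square exp_add[symmetric])
      have "W (z - d) * W (z + d) = (exp (2 * z))\<^sup>2 * ((F A - F (\<phi> (z - d))) * (F A - F (\<phi> (z + d))))"
        unfolding W_def exp_sq[symmetric] by (simp only: mult_ac)
      also have "\<dots> \<le> (exp (2 * z))\<^sup>2 * (F A - F (\<phi> z))\<^sup>2"
        using D[OF that] by (intro mult_left_mono) auto
      finally show ?thesis by (simp add: W_def power_mult_distrib)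
    qed
    show "0 < c * A" using c A by simp
    show "\<forall>\<^sub>F x in at_top. c * A \<le> W x"
      using eventually_gt_at_top[of 0] by eventually_elim (rule W_ge)
  qed (use that in auto)
  have W_eq: "W (ln (A / u) / 2) = A * ((F A - F (A - u)) / u)" if "0 < u" "u < A" for u
  proof -
    have "\<phi> (ln (A / u) / 2) = A - u"
      using A that by (simp add: \<phi>_def exp_minus right_diff_distrib)
    then show ?thesis using A that by (simp add: W_def)
  qed
  have "W (ln (A / v) / 2) \<le> W (ln (A / u) / 2)"
    using A uv by (intro W_mono) (auto simp: ln_div)
  moreover have "0 < v" "u < A" using uv by simp_all
  ultimately have "A * ((F A - F (A - v)) / v) \<le> A * ((F A - F (A - u)) / u)"
    using W_eq uv by (simp only:)
  then show ?thesis using A by (simp only: mult_le_cancel_left_pos)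
qed

end

section \<open>Vanishing of the remainder\<close>

context tp_preserver
begin

text \<open>Here \<open>S\<close> is the remainder of \<open>F\<close> beyond its tangent at \<open>A\<close>, nonnegative by convexity. The log-concave
  function \<open>V\<close> equals a constant plus \<open>exp (3 x) S\<close>; bounded below it is increasing, and it tends to
  the constant because \<open>S\<close> is at most quadratic.\<close>

lemma F_affine_below:
  assumes A: "0 < A" and \<delta>: "0 < \<delta>"
    and touch: "\<And>x. \<bar>x - A\<bar> \<le> \<delta> \<Longrightarrow> F x \<le> F A + m * (x - A) + C * (x - A)\<^sup>2"
    and u: "0 < u" "u < A"
  shows "F (A - u) = F A - m * u"
proof -
  define S where "S u = F (A - u) - F A + m * u" for u
  have S_nonneg: "0 \<le> S u" if u: "0 < u" "u < A" for u
  proof -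
    \<comment> \<open>By convexity the chord from \<open>A - u\<close> to \<open>A + v\<close> is no
      steeper than the one from \<open>A\<close> to \<open>A + v\<close>, which the parabola bounds;
      then \<open>v\<close> tends to 0.\<close>
    have "(F (A + v) - F (A - u)) / (u + v) \<le> m + C * v" if v: "0 < v" "v < \<delta>" for v
    proof -
      have "(F (A + v) - F (A - u)) / (u + v) \<le> (F (A + v) - F A) / v"
        using F_slope_antimono[of "A + v" v "u + v"] A u v by (simp add: algebra_simps)
      also have "\<dots> \<le> (m * v + C * v\<^sup>2) / v"
        using touch[of "A + v"] v by (intro divide_right_mono) auto
      also have "\<dots> = m + C * v" using v by (simp add: power2_eq_square add_divide_distrib)
      finally show ?thesis .
    qed
    then have "\<forall>\<^sub>F v in at_right 0. (F (A + v) - F (A - u)) / (u + v) \<le> m + C * v"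
      using \<delta> by (auto simp: eventually_at_right_field)
    moreover have "((\<lambda>v. (F (A + v) - F (A - u)) / (u + v)) \<longlongrightarrow> (F (A + 0) - F (A - u)) / (u + 0)) (at_right 0)"
      using A u by (intro tendsto_intros isCont_tendsto_compose[OF F_isCont]) auto
    moreover have "((\<lambda>v. m + C * v) \<longlongrightarrow> m + C * 0) (at_right 0)"
      by (intro tendsto_intros)
    ultimately have "(F A - F (A - u)) / u \<le> m"
      using tendsto_le[of "at_right (0::real)" "\<lambda>v. m + C * v"] by auto
    then show ?thesis using u by (simp add: S_def field_simps)
  qed
  have S_le: "S u \<le> C * u\<^sup>2" if "0 < u" "u \<le> \<delta>" for u
    using touch[of "A - u"] that by (simp add: S_def)
  have "0 < m * (A / 2)"
    using S_nonneg[of "A / 2"] F_less[of "A - A / 2" A] A by (simp add: S_def)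
  then have m: "0 < m" using A by (simp add: zero_less_mult_iff)
  define \<phi> where "\<phi> x = A * (1 - 3 * exp (- 2 * x) + 2 * exp (- 3 * x))" for x :: real
  define r where "r x = A - \<phi> x" for x
  \<comment> \<open>With \<open>w = exp (- x)\<close> this reads
    \<open>A * w\<^sup>2 * (3 - 2 * w)\<close>: a leading term of order 2 and a correction of order
    3, but nothing of order 4.\<close>
  have r_eq: "r x = A * exp (- 2 * x) * (3 - 2 * exp (- x))" for x
    by (simp add: r_def \<phi>_def algebra_simps exp_add[symmetric])
  have \<phi>_eq: "\<phi> x = A * (1 - exp (- x))\<^sup>2 * (1 + 2 * exp (- x))" for x
    by (simp add: \<phi>_def power2_eq_square algebra_simps exp_add[symmetric])
  have \<phi>_pos: "0 < \<phi> x" if "0 < x" for x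
    unfolding \<phi>_eq using A that by (intro mult_pos_pos) (auto intro: add_pos_pos)
  have r_pos: "0 < r x" if "0 < x" for x
  proof -
    have "exp (- x) < 1" using that by simp
    then have "0 < 3 - 2 * exp (- x)" by linarith
    then show ?thesis unfolding r_eq using A by (intro mult_pos_pos) auto
  qed
  have r_less: "r x < A" if "0 < x" for x using \<phi>_pos[OF that] by (simp add: r_def)
  have S_r: "F (\<phi> x) = F A - m * r x + S (r x)" for x
    by (simp add: S_def r_def)
  obtain f where f: "\<And>m. tp_function (f m)" "\<And>x. 0 < x \<Longrightarrow> (\<lambda>m. f m x) \<longlonglongrightarrow> \<phi> x"
    using tp_limits(2)[OF A] unfolding \<phi>_def by blast
  have \<phi>_lim: "(\<phi> \<longlongrightarrow> A) at_top" unfolding \<phi>_def by real_asymp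
  have r_lim: "(r \<longlongrightarrow> 0) at_top" unfolding r_def using tendsto_diff[OF tendsto_const \<phi>_lim, of A] by simp
  have "nonneg_minors (\<lambda>x. F A - F (\<phi> x))"
  proof (rule nonneg_minors_reduce)
    fix z d :: real and M N :: nat
    assume d: "0 < d" "d < z" and N: "2 \<le> N" "2 * N < M"
    have less4: "i < 4 \<longleftrightarrow> i = 0 \<or> i = 1 \<or> i = 2 \<or> i = (3 :: nat)" for i by auto
    show "0 \<le> det (mat 4 4 (\<lambda>(i, j). F (\<phi> (z + d * (real ([M, M + 1, M + N, 2 * M] ! i) - real ([0, M - N, M, M + 1] ! j))))))"
    proof (rule det_limit_nonneg[where f = f])
      show "strict_mono_on {..<4} ((!) [M, M + 1, M + N, 2 * M])" "strict_mono_on {..<4} ((!) [0, M - N, M, M + 1])"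
        using N by (auto simp: strict_mono_on_def less4)
      fix i j :: nat assume "i < 4" "j < 4"
      then have "- 1 \<le> real ([M, M + 1, M + N, 2 * M] ! i) - real ([0, M - N, M, M + 1] ! j)"
        using N by (auto simp: less4)
      then have "d * (- 1) \<le> d * (real ([M, M + 1, M + N, 2 * M] ! i) - real ([0, M - N, M, M + 1] ! j))"
        using d by (intro mult_left_mono) auto
      then show "0 < z + d * (real ([M, M + 1, M + N, 2 * M] ! i) - real ([0, M - N, M, M + 1] ! j))"
        using d by simp
    qed (use f \<phi>_pos d in auto)
  next
    show "((\<lambda>x. F (\<phi> x)) \<longlongrightarrow> F A) at_top"
      by (rule isCont_tendsto_compose[OF F_isCont[OF A] \<phi>_lim])
    show "0 < F A" by (rule F_pos[OF A])
  qed
  \<comment> \<open>The weight gives the function the positive limit \<open>3 * A * m\<close>, so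
    the limit at infinity can be subtracted a second time.\<close>
  then have minors: "nonneg_minors (\<lambda>x. exp (2 * x) * (F A - F (\<phi> x)))"
    by (rule nonneg_minors_exp_mult)
  define E where "E x = 3 * A * m - exp (2 * x) * (F A - F (\<phi> x))" for x
  define V where "V x = exp x * E x" for x
  have E_eq: "E x = 2 * A * m * exp (- x) + exp (2 * x) * S (r x)" for x
  proof -
    have "exp (2 * x) * (m * r x) = A * m * (3 - 2 * exp (- x))"
      by (simp add: r_eq exp_minus)
    then show ?thesis by (simp add: E_def S_r algebra_simps)
  qed
  have V_eq: "V x = 2 * A * m + exp (3 * x) * S (r x)" for x
    by (simp add: V_def E_eq distrib_left mult.assoc[symmetric] exp_add[symmetric])
  \<comment> \<open>As \<open>r x\<close> is of order \<open>exp (- 2 * x)\<close>, the remainder is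
    at most of order \<open>exp (- 4 * x)\<close>.\<close>
  have remainder_lim: "((\<lambda>x. exp (3 * x) * S (r x)) \<longlongrightarrow> 0) at_top"
  proof (rule tendsto_sandwich[OF _ _ tendsto_const])
    have ev: "\<forall>\<^sub>F x in at_top. r x < \<delta>" using order_tendstoD(2)[OF r_lim \<delta>] .
    show "\<forall>\<^sub>F x in at_top. 0 \<le> exp (3 * x) * S (r x)"
      using eventually_gt_at_top[of 0] by eventually_elim (simp add: S_nonneg r_pos r_less)
    show "\<forall>\<^sub>F x in at_top. exp (3 * x) * S (r x) \<le> exp (3 * x) * (C * (A * exp (- 2 * x) * (3 - 2 * exp (- x)))\<^sup>2)"
      using ev eventually_gt_at_top[of 0]
    proof eventually_elim
      case (elim x)
      then show ?case
        unfolding r_eq[symmetric] using S_le[of "r x"] r_pos[of x] by (intro mult_left_mono) auto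
    qed
    have "((\<lambda>x. C * A\<^sup>2 * (exp (3 * x) * (exp (- 2 * x) * (3 - 2 * exp (- x)))\<^sup>2)) \<longlongrightarrow> C * A\<^sup>2 * 0) at_top"
      by (intro tendsto_mult tendsto_const) real_asymp
    then show "((\<lambda>x. exp (3 * x) * (C * (A * exp (- 2 * x) * (3 - 2 * exp (- x)))\<^sup>2)) \<longlongrightarrow> 0) at_top"
      by (simp add: power_mult_distrib mult_ac)
  qed
  have "((\<lambda>x. exp (2 * x) * (F A - F (\<phi> x))) \<longlongrightarrow> 3 * A * m) at_top"
  proof -
    have "((\<lambda>x. exp (- x) * (exp (3 * x) * S (r x))) \<longlongrightarrow> 0 * 0) at_top"
      by (rule tendsto_mult[OF _ remainder_lim]) real_asymp
    then have "((\<lambda>x. exp (2 * x) * S (r x)) \<longlongrightarrow> 0) at_top"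
      by (simp add: mult.assoc[symmetric] exp_add[symmetric])
    moreover have "((\<lambda>x. 2 * A * m * exp (- x)) \<longlongrightarrow> 2 * A * m * 0) at_top"
      by (intro tendsto_mult tendsto_const) real_asymp
    ultimately have "((\<lambda>x. 3 * A * m - E x) \<longlongrightarrow> 3 * A * m - (2 * A * m * 0 + 0)) at_top"
      unfolding E_eq by (intro tendsto_diff tendsto_add tendsto_const)
    then show ?thesis by (simp add: E_def)
  qed
  from nonneg_minors_imp_log_concave[OF minors this]
  have E_lc: "E (z - d) * E (z + d) \<le> (E z)\<^sup>2" if "0 < d" "d < z" for z d
    using A m that by (simp add: E_def)
  have V_ge: "2 * A * m \<le> V x" if "0 < x" for x
    using S_nonneg[OF r_pos[OF that] r_less[OF that]] by (simp add: V_eq)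
  have "V x \<le> V y" if "0 < x" "x < y" for x y
  proof (rule log_concave_bounded_below_mono[of V])
    show "0 < V x" if "0 < x" for x
      using less_le_trans[OF _ V_ge[OF that]] A m by simp
    show "V (z - d) * V (z + d) \<le> (V z)\<^sup>2" if "0 < d" "d < z" for z d
    proof -
      have "V (z - d) * V (z + d) = (exp z)\<^sup>2 * (E (z - d) * E (z + d))"
        by (simp add: V_def power2_eq_square exp_add exp_diff)
      also have "\<dots> \<le> (exp z)\<^sup>2 * (E z)\<^sup>2"
        using E_lc[OF that] by (intro mult_left_mono) auto
      finally show ?thesis by (simp add: V_def power_mult_distrib)
    qed
    show "0 < 2 * A * m" using A m by simp
    show "\<forall>\<^sub>F x in at_top. 2 * A * m \<le> V x"
      using eventually_gt_at_top[of 0] by eventually_elim (rule V_ge)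
  qed (use that in auto)
  moreover have "(V \<longlongrightarrow> 2 * A * m + 0) at_top"
    unfolding V_eq[abs_def] by (intro tendsto_intros remainder_lim)
  ultimately have V_le: "V x \<le> 2 * A * m" if "0 < x" for x
  proof (intro tendsto_lowerbound[of V "2 * A * m" at_top])
    show "\<forall>\<^sub>F y in at_top. V x \<le> V y"
      using eventually_gt_at_top[of x]
      by eventually_elim (use \<open>\<And>x y. 0 < x \<Longrightarrow> x < y \<Longrightarrow> V x \<le> V y\<close> that in auto)
  qed auto
  have S_zero: "S (r x) = 0" if "0 < x" for x
  proof (rule antisym)
    have "exp (3 * x) * S (r x) \<le> 0" using V_le[OF that] by (simp add: V_eq)
    then show "S (r x) \<le> 0" by (simp add: mult_le_0_iff)
  qed (rule S_nonneg[OF r_pos[OF that] r_less[OF that]])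
  \<comment> \<open>By the intermediate value theorem \<open>r\<close> takes every value
    \<open>u\<close> in the open interval from 0 to \<open>A\<close>, at
    \<open>x = - ln w\<close>.\<close>
  have "continuous_on {0..1} (\<lambda>w. A * w\<^sup>2 * (3 - 2 * w))"
    by (intro continuous_intros)
  then obtain w where w: "0 \<le> w" "w \<le> 1" "A * w\<^sup>2 * (3 - 2 * w) = u"
    using IVT'[of "\<lambda>w. A * w\<^sup>2 * (3 - 2 * w)" 0 u 1] u by auto
  then have "w \<noteq> 0" "w \<noteq> 1" using u by auto
  with w have "0 < w" "w < 1" by auto
  then have "r (- ln w) = u" "0 < - ln w"
    using w(3) by (auto simp: r_eq exp_double)
  with S_zero[of "- ln w"] show ?thesis by (simp add: S_def)
qed

text \<open>A parabola agreeing with \<open>F\<close> at \<open>N\<close> and \<open>N + 1\<close>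
  is subtracted. With enough curvature the difference is positive at the midpoint, so its maximum is
  interior; there a vertical translate of the parabola touches from above.\<close>

lemma F_touching_parabola:
  assumes "0 < N"
  obtains A m C \<delta> where "N < A" "0 < \<delta>"
    "\<And>x. \<bar>x - A\<bar> \<le> \<delta> \<Longrightarrow> F x \<le> F A + m * (x - A) + C * (x - A)\<^sup>2"
proof -
  define s where "s = F (N + 1) - F N"
  \<comment> \<open>The quadratic term equals \<open>- C / 4\<close> at the midpoint, so
    \<open>C / 4\<close> must exceed the deviation of \<open>F\<close> from its chord there.\<close>
  define C where "C = 4 * \<bar>F N + s / 2 - F (N + 1 / 2)\<bar> + 4"
  define H where "H x = F x - (F N + s * (x - N) + C * (x - N) * (x - N - 1))" for x
  have "continuous_on {N..N + 1} H"
    unfolding H_def using assms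
    by (intro continuous_intros continuous_at_imp_continuous_on ballI F_isCont) auto
  then obtain A where A: "A \<in> {N..N + 1}" "\<And>x. x \<in> {N..N + 1} \<Longrightarrow> H x \<le> H A"
    using continuous_attains_sup[of "{N..N + 1}" H] by auto
  have "H N = 0" "H (N + 1) = 0" by (simp_all add: H_def s_def)
  moreover have "H (N + 1 / 2) = F (N + 1 / 2) - (F N + s / 2) + C / 4"
    by (simp add: H_def field_simps)
  then have "0 < H (N + 1 / 2)" unfolding C_def by (simp add: add_divide_distrib)
  ultimately have "A \<noteq> N" "A \<noteq> N + 1" using A(2)[of "N + 1 / 2"] by auto
  then have "N < A" "A < N + 1" using A(1) by auto
  show thesis
  proof
    show "N < A" by fact
    show "0 < min (A - N) (N + 1 - A)" using \<open>N < A\<close> \<open>A < N + 1\<close> by simp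
    fix x assume "\<bar>x - A\<bar> \<le> min (A - N) (N + 1 - A)"
    then have "H x \<le> H A" by (intro A(2)) (auto simp: abs_le_iff)
    then show "F x \<le> F A + (s + C * (2 * A - 2 * N - 1)) * (x - A) + C * (x - A)\<^sup>2"
      by (simp add: H_def power2_eq_square algebra_simps)
  qed
qed

text \<open>\<open>F\<close> is affine on every bounded initial interval, and the values at 1 and 2
  force the same coefficients on all of them.\<close>

lemma F_linear: "\<exists>c>0. \<forall>t>0. F t = c * t"
proof -
  have affine: "\<exists>c d. \<forall>t. 0 < t \<and> t \<le> N \<longrightarrow> F t = c * t + d" if "0 < N" for N
  proof -
    obtain A m C \<delta> where A: "N < A" "0 < \<delta>"
      "\<And>x. \<bar>x - A\<bar> \<le> \<delta> \<Longrightarrow> F x \<le> F A + m * (x - A) + C * (x - A)\<^sup>2"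
      using F_touching_parabola[OF \<open>0 < N\<close>] by metis
    have "F t = m * t + (F A - m * A)" if "0 < t" "t \<le> N" for t
      using F_affine_below[OF _ A(2,3), of "A - t"] A(1) that by (simp add: algebra_simps)
    then show ?thesis by blast
  qed
  obtain c d where cd: "\<And>t. 0 < t \<Longrightarrow> t \<le> 4 \<Longrightarrow> F t = c * t + d"
    using affine[of 4] by auto
  have F_eq: "F t = c * t + d" if t: "0 < t" for t
  proof -
    obtain c' d' where cd': "\<And>s. 0 < s \<Longrightarrow> s \<le> max t 4 \<Longrightarrow> F s = c' * s + d'"
      using affine[OF max.strict_coboundedI1[OF t]] by blast
    have "c' + d' = c + d" "2 * c' + d' = 2 * c + d"
      using cd[of 1] cd[of 2] cd'[of 1] cd'[of 2] by simp_all
    then have "c' = c" "d' = d" by linarith+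
    then show ?thesis using cd'[of t] t by simp
  qed
  have "0 < c" using F_less[of 1 2] F_eq[of 1] F_eq[of 2] by simp
  \<comment> \<open>The geometric triple 1, 2, 4 in \<open>F_mid\<close> leaves
    \<open>5 * c * d \<le> 4 * c * d\<close>.\<close>
  have "c * d \<le> 0"
    using F_mid[of 1 2 4] F_eq[of 1] F_eq[of 2] F_eq[of 4] by (simp add: power2_eq_square algebra_simps)
  then have "d \<le> 0" using \<open>0 < c\<close> by (simp add: mult_le_0_iff)
  moreover have "\<not> d < 0"
  proof
    assume "d < 0"
    \<comment> \<open>At this point the affine formula gives \<open>d / 2\<close>, which would be
      negative.\<close>
    then have "0 < - d / (2 * c)" using \<open>0 < c\<close> by (simp add: divide_neg_pos)
    from F_pos[OF this] F_eq[OF this] \<open>d < 0\<close> \<open>0 < c\<close> show False by simp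
  qed
  ultimately show ?thesis using F_eq \<open>0 < c\<close> by auto
qed

end

section \<open>The converse and the equivalence\<close>

lemma totally_positive_cmult:
  assumes "totally_positive X Y K" "0 < c" and eq: "\<And>x y. x \<in> X \<Longrightarrow> y \<in> Y \<Longrightarrow> F (K x y) = c * K x y"
  shows "totally_positive X Y (\<lambda>x y. F (K x y))"
  unfolding totally_positive_def
proof (intro allI impI)
  fix n x y assume n: "1 \<le> n" and x: "increasing_tuple n X x" and y: "increasing_tuple n Y y"
  then have "0 < det (mat n n (\<lambda>(i, j). K (x i) (y j)))"
    using assms(1) by (auto simp: totally_positive_def)
  then have "0 < (\<Prod>i<n. c) * (\<Prod>j<n. 1) * det (mat n n (\<lambda>(i, j). K (x i) (y j)))"
    using \<open>0 < c\<close> by simp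
  also have "\<dots> = det (mat n n (\<lambda>(i, j). F (K (x i) (y j))))"
    unfolding det_scale[symmetric] using x y
    by (intro det_mat_cong) (auto simp: eq increasing_tuple_def image_subset_iff)
  finally show "0 < det (mat n n (\<lambda>(i, j). F (K (x i) (y j))))" .
qed

lemma totally_positive_entry_pos:
  assumes "totally_positive X Y K" "x \<in> X" "y \<in> Y"
  shows "0 < K x y"
proof -
  have "increasing_tuple 1 X (\<lambda>_. x)" "increasing_tuple 1 Y (\<lambda>_. y)"
    using assms by (auto simp: increasing_tuple_def strict_mono_on_def)
  then have "0 < det (mat 1 1 (\<lambda>(i, j). K x y))"
    using assms(1)[unfolded totally_positive_def, rule_format, of 1 "\<lambda>_. x" "\<lambda>_. y"] by simp
  then show ?thesis by (simp add: det_single)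
qed

theorem theorem9p5:
  fixes X Y :: "real set" and F :: "real \<Rightarrow> real"
  assumes "admissible X Y"
    and "\<And>t. t > 0 \<Longrightarrow> F t > 0"
  shows "(\<forall>K. toeplitz_kernel X Y K \<and> totally_positive X Y K \<longrightarrow>
             totally_positive X Y (\<lambda>x y. F (K x y)))
         \<longleftrightarrow> (\<exists>c>0. \<forall>t>0. F t = c * t)"
proof
  assume "\<forall>K. toeplitz_kernel X Y K \<and> totally_positive X Y K \<longrightarrow>
    totally_positive X Y (\<lambda>x y. F (K x y))"
  then have "tp_preserver F"
    using assms by (intro admissible_imp_tp_preserver) auto
  then show "\<exists>c>0. \<forall>t>0. F t = c * t" by (rule tp_preserver.F_linear)
next
  assume "\<exists>c>0. \<forall>t>0. F t = c * t"
  then obtain c where c: "0 < c" "\<And>t. 0 < t \<Longrightarrow> F t = c * t" by blast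
  show "\<forall>K. toeplitz_kernel X Y K \<and> totally_positive X Y K \<longrightarrow>
      totally_positive X Y (\<lambda>x y. F (K x y))"
  proof (intro allI impI, elim conjE)
    fix K assume "totally_positive X Y K"
    then show "totally_positive X Y (\<lambda>x y. F (K x y))"
      by (rule totally_positive_cmult[OF _ c(1)]) (rule c(2)[OF totally_positive_entry_pos[OF \<open>totally_positive X Y K\<close>]])
  qed
qed

end
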